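(* Let $A=\mathbb{Z}_{(2)}[x]/(x^2+x+1)$, which is an unramified discrete valuation ring with uniformizer $2$. Let $V=\widehat{A}$ be its $2$-adic completion, let $L$ be the fraction field of $A$, and let $K$ be the fraction field of $V$, so that $L$ and $V$ are both contained in $K$. For $w\in K$, set $R_w = L(w)\cap V$. Then there exists $w \in K$ such that $R_w$ is an unramified discrete valuation ring which has no $2$-derivations.
   Context: A discrete valuation ring of mixed characteristic $(0,p)$ is unramified if the prime integer $p$ is a uniformizer; here $p=2$. Let $S$ be a commutative ring with unity and $p$ a prime integer that is a nonzerodivisor on $S$. A set-theoretic function $\delta: S\to S$ is a $p$-derivation if the function $\phi_p:S\to S$, $\phi_p(s)=s^p+p\delta(s)$, is a ring homomorphism. *)

theory Defs
  imports "HOL-Algebra.Generated_Fields" "HOL-Algebra.Polynomial_Divisibility"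
begin

section \<open>Mixed characteristic discrete valuation rings\<close>

text \<open>The case \<open>n = 0\<close> is characteristic zero.\<close>

definition has_char :: "('a, 'm) ring_scheme \<Rightarrow> nat \<Rightarrow> bool" where
  "has_char R n \<longleftrightarrow> (\<forall>k::nat. [k] \<cdot>\<^bsub>R\<^esub> \<one>\<^bsub>R\<^esub> = \<zero>\<^bsub>R\<^esub> \<longleftrightarrow> n dvd k)"

definition discrete_valuation_ring :: "('a, 'm) ring_scheme \<Rightarrow> bool" where
  "discrete_valuation_ring R \<longleftrightarrow>
     principal_domain R \<and> \<not> field R \<and> (\<exists>!M. maximalideal M R)"

definition uniformizer :: "('a, 'm) ring_scheme \<Rightarrow> 'a \<Rightarrow> bool" where
  "uniformizer R t \<longleftrightarrow> t \<in> carrier R \<and> maximalideal (PIdl\<^bsub>R\<^esub> t) R"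

definition mixed_char_dvr :: "nat \<Rightarrow> ('a, 'm) ring_scheme \<Rightarrow> bool" where
  "mixed_char_dvr p R \<longleftrightarrow>
     discrete_valuation_ring R \<and> has_char R 0 \<and>
     (\<forall>M. maximalideal M R \<longrightarrow> has_char (R Quot M) p)"

definition unramified_dvr :: "nat \<Rightarrow> ('a, 'm) ring_scheme \<Rightarrow> bool" where
  "unramified_dvr p R \<longleftrightarrow> mixed_char_dvr p R \<and> uniformizer R ([p] \<cdot>\<^bsub>R\<^esub> \<one>\<^bsub>R\<^esub>)"


section \<open>p-derivations\<close>

text \<open>Meant for a commutative ring \<open>S\<close> and a prime \<open>p\<close> that is a nonzerodivisor on \<open>S\<close>; in
  particular these side conditions hold in every mixed characteristic discrete valuation ring.\<close>

definition p_derivation :: "nat \<Rightarrow> ('a, 'm) ring_scheme \<Rightarrow> ('a \<Rightarrow> 'a) \<Rightarrow> bool" where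
  "p_derivation p S \<delta> \<longleftrightarrow>
     \<delta> \<in> carrier S \<rightarrow> carrier S \<and>
     (\<lambda>s. s [^]\<^bsub>S\<^esub> p \<oplus>\<^bsub>S\<^esub> [p] \<cdot>\<^bsub>S\<^esub> \<delta> s) \<in> ring_hom S S"


section \<open>Localization of the integers at a prime\<close>

definition int_localization :: "nat \<Rightarrow> rat ring" where
  "int_localization p =
     \<lparr>carrier = {of_int a / of_int b | a b :: int. \<not> int p dvd b},
      monoid.mult = (*), one = 1, ring.zero = 0, add = (+)\<rparr>"


section \<open>p-adic completion\<close>

abbreviation p_power_ideal :: "('a, 'm) ring_scheme \<Rightarrow> nat \<Rightarrow> nat \<Rightarrow> 'a set" where
  "p_power_ideal R p n \<equiv> PIdl\<^bsub>R\<^esub> ([(p ^ n)] \<cdot>\<^bsub>R\<^esub> \<one>\<^bsub>R\<^esub>)"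

text \<open>The inverse limit of the quotients \<open>R / p\<^sup>n R\<close>. An element is a compatible sequence of
  cosets; the transition map sends a coset of \<open>p\<^sup>n\<^sup>+\<^sup>1 R\<close> to the unique coset of \<open>p\<^sup>n R\<close>
  containing it, so compatibility is inclusion.\<close>

definition p_completion :: "('a, 'm) ring_scheme \<Rightarrow> nat \<Rightarrow> (nat \<Rightarrow> 'a set) ring" where
  "p_completion R p =
     \<lparr>carrier = {s. (\<forall>n. s n \<in> carrier (R Quot p_power_ideal R p n)) \<and>
                    (\<forall>n. s (Suc n) \<subseteq> s n)},
      monoid.mult = (\<lambda>s t n. s n \<otimes>\<^bsub>R Quot p_power_ideal R p n\<^esub> t n),
      one = (\<lambda>n. \<one>\<^bsub>R Quot p_power_ideal R p n\<^esub>),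
      ring.zero = (\<lambda>n. \<zero>\<^bsub>R Quot p_power_ideal R p n\<^esub>),
      add = (\<lambda>s t n. s n \<oplus>\<^bsub>R Quot p_power_ideal R p n\<^esub> t n)\<rparr>"

definition to_p_completion :: "('a, 'm) ring_scheme \<Rightarrow> nat \<Rightarrow> 'a \<Rightarrow> nat \<Rightarrow> 'a set" where
  "to_p_completion R p a = (\<lambda>n. p_power_ideal R p n +>\<^bsub>R\<^esub> a)"


section \<open>Fraction fields\<close>

definition frac_rel :: "('a, 'm) ring_scheme \<Rightarrow> (('a \<times> 'a) \<times> ('a \<times> 'a)) set" where
  "frac_rel R =
     {((a, b), (c, d)) | a b c d.
        a \<in> carrier R \<and> b \<in> carrier R - {\<zero>\<^bsub>R\<^esub>} \<and>
        c \<in> carrier R \<and> d \<in> carrier R - {\<zero>\<^bsub>R\<^esub>} \<and>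
        a \<otimes>\<^bsub>R\<^esub> d = c \<otimes>\<^bsub>R\<^esub> b}"

definition frac_class :: "('a, 'm) ring_scheme \<Rightarrow> 'a \<Rightarrow> 'a \<Rightarrow> ('a \<times> 'a) set" where
  "frac_class R a b = frac_rel R `` {(a, b)}"

text \<open>Operations on classes are written as unions over all representatives; for a domain the
  united classes coincide.\<close>

definition fraction_field :: "('a, 'm) ring_scheme \<Rightarrow> ('a \<times> 'a) set ring" where
  "fraction_field R =
     \<lparr>carrier = (carrier R \<times> (carrier R - {\<zero>\<^bsub>R\<^esub>})) // frac_rel R,
      monoid.mult = (\<lambda>C D. \<Union>(a, b)\<in>C. \<Union>(c, d)\<in>D. frac_class R (a \<otimes>\<^bsub>R\<^esub> c) (b \<otimes>\<^bsub>R\<^esub> d)),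
      one = frac_class R \<one>\<^bsub>R\<^esub> \<one>\<^bsub>R\<^esub>,
      ring.zero = frac_class R \<zero>\<^bsub>R\<^esub> \<one>\<^bsub>R\<^esub>,
      add = (\<lambda>C D. \<Union>(a, b)\<in>C. \<Union>(c, d)\<in>D.
               frac_class R (a \<otimes>\<^bsub>R\<^esub> d \<oplus>\<^bsub>R\<^esub> c \<otimes>\<^bsub>R\<^esub> b) (b \<otimes>\<^bsub>R\<^esub> d))\<rparr>"

definition to_fraction_field :: "('a, 'm) ring_scheme \<Rightarrow> 'a \<Rightarrow> ('a \<times> 'a) set" where
  "to_fraction_field R a = frac_class R a \<one>\<^bsub>R\<^esub>"

text \<open>The map \<open>a / b \<mapsto> h a / h b\<close> of fraction fields induced by an injective ring
  homomorphism \<open>h\<close> into the domain \<open>S\<close>.\<close>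

definition fraction_field_map ::
  "('b, 'm) ring_scheme \<Rightarrow> ('a \<Rightarrow> 'b) \<Rightarrow> ('a \<times> 'a) set \<Rightarrow> ('b \<times> 'b) set" where
  "fraction_field_map S h C = (\<Union>(a, b)\<in>C. frac_class S (h a) (h b))"


section \<open>The rings of the example\<close>

text \<open>Elements of \<^const>\<open>univ_poly\<close> are coefficient lists, leading coefficient first, so the
  list below is \<open>x\<^sup>2 + x + 1\<close>.\<close>

definition ring_A :: "rat list set ring" where
  "ring_A =
     (let P = poly_ring (int_localization 2) in P Quot (PIdl\<^bsub>P\<^esub> [1, 1, 1]))"

definition ring_V :: "(nat \<Rightarrow> rat list set set) ring" where
  "ring_V = p_completion ring_A 2"

definition field_K :: "((nat \<Rightarrow> rat list set set) \<times> (nat \<Rightarrow> rat list set set)) set ring" where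
  "field_K = fraction_field ring_V"

definition L_in_K :: "((nat \<Rightarrow> rat list set set) \<times> (nat \<Rightarrow> rat list set set)) set set" where
  "L_in_K =
     fraction_field_map ring_V (to_p_completion ring_A 2) ` carrier (fraction_field ring_A)"

definition V_in_K :: "((nat \<Rightarrow> rat list set set) \<times> (nat \<Rightarrow> rat list set set)) set set" where
  "V_in_K = to_fraction_field ring_V ` carrier ring_V"

definition ring_R ::
  "((nat \<Rightarrow> rat list set set) \<times> (nat \<Rightarrow> rat list set set)) set \<Rightarrow>
   ((nat \<Rightarrow> rat list set set) \<times> (nat \<Rightarrow> rat list set set)) set ring" where
  "ring_R w = field_K\<lparr>carrier := generate_field field_K (L_in_K \<union> {w}) \<inter> V_in_K\<rparr>"

end

theory Submission
  imports Defs "HOL-Computational_Algebra.Primes"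
begin

text \<open>Write \<open>\<omega>\<close> for the class of \<open>x\<close> in \<open>A\<close>, a primitive cube root of unity. The witness is
  an element \<open>w \<in> V\<close> with \<open>w\<^sup>2 = 1 + 8\<omega>\<close>, so that \<open>L(w)\<close> is a quadratic extension of \<open>L\<close>.

  A 2-derivation on \<open>R\<^sub>w\<close> gives a ring endomorphism \<open>\<phi>\<close> with \<open>\<phi>(s) - s\<^sup>2 \<in> 2R\<^sub>w\<close> for all \<open>s\<close>. As a
  root of \<open>x\<^sup>2 + x + 1\<close>, the element \<open>\<phi>(\<omega>)\<close> is \<open>\<omega>\<close> or \<open>\<omega>\<^sup>2\<close>. The first value is excluded, because
  \<open>\<omega> - \<omega>\<^sup>2 = 2\<omega> + 1\<close> would then lie in \<open>2R\<^sub>w\<close> and 2 would be a unit. Therefore \<open>\<phi>(\<omega>) = \<omega>\<^sup>2\<close>, and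
  \<open>\<phi>(w)\<close> is a square root of \<open>1 + 8\<omega>\<^sup>2\<close> inside \<open>L(w)\<close>. Such a root does not exist: a square root of
  \<open>e \<in> L\<close> in \<open>L(\<surd>d)\<close> forces one of \<open>d\<close>, \<open>e\<close>, \<open>de\<close> to be a square in \<open>L\<close>
  (\<open>square_in_quadratic_extension\<close>), whereas \<open>1 + 8\<omega>\<close> and \<open>1 + 8\<omega>\<^sup>2\<close> have norm 57, which is not a
  rational square, and their product is 57 itself, which is not a square in \<open>\<rat>(\<omega>)\<close>.

  The root \<open>w = 1 + 2u\<close> comes from a solution of \<open>u\<^sup>2 + u = 2\<omega>\<close> in \<open>V\<close>, which the iteration
  \<open>u \<mapsto> 2\<omega> - u\<^sup>2\<close>, a 2-adic contraction on the multiples of 2, approximates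
  (\<open>completion_quadratic_root\<close>).

  All discrete valuation rings in the argument are recognised through one condition, the locale
  \<open>p_uniformized_ring\<close>: \<open>p\<close> is not a unit, no power of \<open>p\<close> vanishes, and every nonzero element is a
  power of \<open>p\<close> times a unit. It implies that the ring is an unramified discrete valuation ring
  (\<open>is_unramified_dvr\<close>). It holds for \<open>A\<close> by a computation with norms (\<open>A_p_uniformized\<close>), it passes
  to the completion by cancelling a power of \<open>p\<close> from a representing sequence
  (\<open>completion_p_uniformized\<close>), and from there to the intersection with any subfield of the fraction
  field (\<open>subfield_inter_p_uniformized\<close>), in particular to \<open>R\<^sub>w\<close>.\<close>

section \<open>A criterion for unramified discrete valuation rings\<close>

definition nat_image :: "('a, 'm) ring_scheme \<Rightarrow> nat \<Rightarrow> 'a" (\<open>\<iota>\<index>\<close>) where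
  "nat_image R n = [n] \<cdot>\<^bsub>R\<^esub> \<one>\<^bsub>R\<^esub>"

context cring begin

lemma nat_image_closed [simp, intro]: "\<iota> n \<in> carrier R"
  by (simp add: nat_image_def)

lemma nat_image_0 [simp]: "\<iota> 0 = \<zero>"
  by (simp add: nat_image_def)

lemma nat_image_Suc: "\<iota> (Suc n) = \<iota> n \<oplus> \<one>"
  by (simp add: nat_image_def)

lemma nat_image_1 [simp]: "\<iota> 1 = \<one>" "\<iota> (Suc 0) = \<one>"
  by (simp_all add: nat_image_def)

lemma nat_image_add: "\<iota> (m + n) = \<iota> m \<oplus> \<iota> n"
  by (simp add: nat_image_def add.nat_pow_mult)

lemma nat_image_mult: "\<iota> (m * n) = \<iota> m \<otimes> \<iota> n"
  by (simp add: nat_image_def add_pow_ldistr add.nat_pow_pow mult.commute)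

end

locale p_adic_cring = cring R for R (structure) +
  fixes p :: nat

text \<open>A commutative ring of this kind is a domain, so that the last axiom says that \<open>p\<close> is its only
  prime up to units. The condition has an elementwise form because in this form it is inherited by
  completions and by intersections with subfields.\<close>

locale p_uniformized_ring = p_adic_cring +
  assumes prime_p: "normalization_semidom_class.prime p"
    and p_not_unit: "\<iota> p \<notin> Units R"
    and p_power_nonzero: "\<iota> (p ^ n) \<noteq> \<zero>"
    and p_power_factor: "\<lbrakk>x \<in> carrier R; x \<noteq> \<zero>\<rbrakk> \<Longrightarrow> \<exists>n. \<exists>u\<in>Units R. x = \<iota> (p ^ n) \<otimes> u"
begin

lemma is_domain: "domain R"
proof (rule domainI)
  show "cring R" by (rule is_cring)
  show "\<one> \<noteq> \<zero>" using p_power_nonzero[of 0] by simp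
  fix a b assume ab: "a \<otimes> b = \<zero>" "a \<in> carrier R" "b \<in> carrier R"
  show "a = \<zero> \<or> b = \<zero>"
  proof (rule ccontr)
    assume "\<not> (a = \<zero> \<or> b = \<zero>)"
    then obtain m u n v where u: "u \<in> Units R" "a = \<iota> (p ^ m) \<otimes> u"
      and v: "v \<in> Units R" "b = \<iota> (p ^ n) \<otimes> v"
      using p_power_factor ab by metis
    have uv: "u \<otimes> v \<in> Units R" using u v by simp
    have "\<iota> (p ^ (m + n)) \<otimes> (u \<otimes> v) = a \<otimes> b"
      using u v by (simp add: power_add nat_image_mult Units_closed m_ac)
    then have "\<iota> (p ^ (m + n)) \<otimes> (u \<otimes> v) \<otimes> inv (u \<otimes> v) = \<zero>"
      using ab uv Units_inv_closed[OF uv] by simp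
    then have "\<iota> (p ^ (m + n)) = \<zero>"
      using uv by (simp add: m_assoc Units_closed del: Units_m_closed)
    then show False using p_power_nonzero by blast
  qed
qed

end

sublocale p_uniformized_ring \<subseteq> domain R
  by (rule is_domain)

context p_uniformized_ring begin

lemma p_multiples_ideal: "ideal (PIdl (\<iota> p)) R"
  by (simp add: cgenideal_ideal)

lemma unit_not_p_multiple: assumes "u \<in> Units R" shows "u \<notin> PIdl (\<iota> p)"
proof
  assume "u \<in> PIdl (\<iota> p)"
  then obtain x where x: "x \<in> carrier R" "u = x \<otimes> \<iota> p" by (auto simp: cgenideal_def)
  then have "\<iota> p \<in> Units R" using assms
    by (metis nat_image_closed m_comm prod_unit_r unit_factor)
  then show False using p_not_unit by simp
qed

text \<open>The exponent in \<open>p\<^sup>n u\<close> is zero exactly for the units. Since the nonunits therefore form an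
  ideal, the ring is local.\<close>

lemma unit_iff_not_p_multiple:
  assumes "x \<in> carrier R" shows "x \<in> Units R \<longleftrightarrow> x \<notin> PIdl (\<iota> p)"
proof
  assume x: "x \<notin> PIdl (\<iota> p)"
  then have "x \<noteq> \<zero>" using p_multiples_ideal additive_subgroup.zero_closed ideal.axioms(1) by metis
  then obtain n u where n: "u \<in> Units R" "x = \<iota> (p ^ n) \<otimes> u" using p_power_factor assms by metis
  show "x \<in> Units R"
  proof (cases n)
    case (Suc k)
    have "x = (\<iota> (p ^ k) \<otimes> u) \<otimes> \<iota> p"
      using n Suc by (simp add: nat_image_mult Units_closed m_ac)
    then have "x \<in> PIdl (\<iota> p)" using n by (auto simp: cgenideal_def Units_closed)
    then show ?thesis using x by simp
  qed (use n in \<open>simp add: Units_closed\<close>)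
qed (rule unit_not_p_multiple)

lemma proper_ideal_subset:
  assumes "ideal J R" "J \<noteq> carrier R" shows "J \<subseteq> PIdl (\<iota> p)"
proof
  fix x assume x: "x \<in> J"
  interpret J: ideal J R by fact
  have "x \<in> carrier R" using x by auto
  moreover have "x \<notin> Units R"
    by (metis J.ideal_axioms J.one_imp_carrier J.I_r_closed Units_inv_closed Units_r_inv assms(2) x)
  ultimately show "x \<in> PIdl (\<iota> p)" using unit_iff_not_p_multiple by blast
qed

lemma maximal_iff: "maximalideal J R \<longleftrightarrow> J = PIdl (\<iota> p)"
proof
  have proper: "PIdl (\<iota> p) \<noteq> carrier R" using unit_not_p_multiple[of \<one>] by auto
  show max: "maximalideal J R" if "J = PIdl (\<iota> p)"
    unfolding that
  proof (rule maximalidealI[OF p_multiples_ideal])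
    show "carrier R \<noteq> PIdl (\<iota> p)" using proper by simp
    show "J = PIdl (\<iota> p) \<or> J = carrier R" if "ideal J R" "PIdl (\<iota> p) \<subseteq> J" for J
      using proper_ideal_subset that by blast
  qed
  assume "maximalideal J R"
  then interpret J: maximalideal J R .
  show "J = PIdl (\<iota> p)"
    using J.I_maximal[OF p_multiples_ideal] proper J.I_notcarr
      proper_ideal_subset[OF J.ideal_axioms] additive_subgroup.a_subset[OF ideal.axioms(1)[OF p_multiples_ideal]]
    by metis
qed

text \<open>A nonzero ideal is generated by the least power of \<open>p\<close> that it contains.\<close>

lemma ideal_is_principal:
  assumes "ideal I R" shows "\<exists>a\<in>carrier R. I = PIdl a"
proof (cases "I = {\<zero>}")
  case True
  then show ?thesis by (auto intro!: bexI[of _ \<zero>] exI[of _ \<zero>] simp: cgenideal_def)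
next
  case False
  interpret I: ideal I R by fact
  define n where "n = (LEAST n. \<iota> (p ^ n) \<in> I)"
  have mem: "\<iota> (p ^ k) \<in> I" if "x \<in> I" "u \<in> Units R" "x = \<iota> (p ^ k) \<otimes> u" for x k u
  proof -
    have "x \<otimes> inv u = \<iota> (p ^ k)" using that by (simp add: m_assoc Units_closed)
    then show ?thesis using I.I_r_closed[of x "inv u"] that by simp
  qed
  obtain x where x: "x \<in> I" "x \<noteq> \<zero>" using False I.zero_closed by blast
  then have "\<exists>n. \<iota> (p ^ n) \<in> I" using mem p_power_factor[of x] by auto
  then have n: "\<iota> (p ^ n) \<in> I" unfolding n_def by (rule LeastI_ex)
  have "I = PIdl (\<iota> (p ^ n))"
  proof
    show "PIdl (\<iota> (p ^ n)) \<subseteq> I" using cgenideal_minimal[OF assms n] .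
    show "I \<subseteq> PIdl (\<iota> (p ^ n))"
    proof
      fix y assume y: "y \<in> I"
      show "y \<in> PIdl (\<iota> (p ^ n))"
      proof (cases "y = \<zero>")
        case True
        then show ?thesis by (auto simp: cgenideal_def intro!: exI[of _ \<zero>])
      next
        case False
        then obtain k u where k: "u \<in> Units R" "y = \<iota> (p ^ k) \<otimes> u"
          using p_power_factor[of y] y by auto
        then have "n \<le> k" unfolding n_def using mem[OF y] by (intro Least_le) auto
        then have "y = (\<iota> (p ^ (k - n)) \<otimes> u) \<otimes> \<iota> (p ^ n)"
          using k by (simp add: m_ac Units_closed flip: nat_image_mult power_add)
        then show ?thesis using k by (auto simp: cgenideal_def Units_closed)
      qed
    qed
  qed
  then show ?thesis by blast
qed

text \<open>If \<open>k\<close> is prime to \<open>p\<close>, a Bezout relation would make 1 a multiple of \<open>p\<close> in the ring. The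
  equivalence yields both the characteristic of the ring and that of its residue field.\<close>

lemma nat_image_in_p_multiples: "\<iota> k \<in> PIdl (\<iota> p) \<longleftrightarrow> p dvd k"
proof
  assume "p dvd k"
  then show "\<iota> k \<in> PIdl (\<iota> p)"
    by (auto simp: cgenideal_def nat_image_mult dvd_def m_comm)
next
  assume k: "\<iota> k \<in> PIdl (\<iota> p)"
  interpret M: ideal "PIdl (\<iota> p)" R by (rule p_multiples_ideal)
  show "p dvd k"
  proof (rule ccontr)
    assume "\<not> p dvd k"
    then have "coprime k p" "k \<noteq> 0" using prime_p prime_imp_coprime[of p k]
      by (auto simp: coprime_commute intro!: gr0I)
    then obtain x y where xy: "k * x = p * y + 1" using bezout_nat[of k p] by auto
    then have eq: "\<iota> k \<otimes> \<iota> x = \<iota> p \<otimes> \<iota> y \<oplus> \<one>"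
      using nat_image_mult nat_image_add nat_image_1 by metis
    have "\<iota> k \<otimes> \<iota> x \<in> PIdl (\<iota> p)" using M.I_r_closed k by simp
    moreover have "\<iota> p \<otimes> \<iota> y \<in> PIdl (\<iota> p)"
      using M.I_r_closed cgenideal_self by simp
    moreover have "(c \<oplus> \<one>) \<ominus> c = \<one>" if "c \<in> carrier R" for c
      using that one_closed by algebra
    then have "\<iota> k \<otimes> \<iota> x \<ominus> \<iota> p \<otimes> \<iota> y = \<one>" unfolding eq by simp
    ultimately have "\<one> \<in> PIdl (\<iota> p)"
      using M.a_closed[OF _ M.a_inv_closed] by (metis minus_eq)
    then show False using unit_not_p_multiple by blast
  qed
qed

lemma has_char_0: "has_char R 0"
  unfolding has_char_def
proof (intro allI)
  fix k :: nat
  have "\<iota> k \<noteq> \<zero>" if "k > 0"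
  proof -
    have "k \<noteq> 0" "\<not> is_unit p" using that prime_p not_prime_unit by auto
    then have "\<exists>m k'. k = p ^ m * k' \<and> \<not> p dvd k'"
      by (rule multiplicity_decompose') blast
    then obtain m k' where k: "k = p ^ m * k'" "\<not> p dvd k'" by blast
    have "\<iota> k' \<noteq> \<zero>" using k nat_image_in_p_multiples[of k']
      by (metis p_multiples_ideal additive_subgroup.zero_closed ideal.axioms(1))
    then show ?thesis using k p_power_nonzero by (simp add: nat_image_mult integral_iff)
  qed
  then show "[k] \<cdot> \<one> = \<zero> \<longleftrightarrow> 0 dvd k" by (auto simp flip: nat_image_def)
qed

lemma residue_has_char: "has_char (R Quot PIdl (\<iota> p)) p"
proof -
  interpret M: ideal "PIdl (\<iota> p)" R by (rule p_multiples_ideal)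
  interpret Q: cring "R Quot PIdl (\<iota> p)" by (rule M.quotient_is_cring[OF is_cring])
  have "nat_image (R Quot PIdl (\<iota> p)) k = PIdl (\<iota> p) +> \<iota> k" for k
    using ring_hom_zero[OF M.rcos_ring_hom ring_axioms M.quotient_is_ring] M.rcos_ring_hom
    by (induction k) (auto simp: nat_image_Suc Q.nat_image_Suc ring_hom_add ring_hom_one)
  moreover have "PIdl (\<iota> p) +> \<iota> k = \<zero>\<^bsub>R Quot PIdl (\<iota> p)\<^esub> \<longleftrightarrow> p dvd k" for k
  proof -
    have "PIdl (\<iota> p) +> \<iota> k = PIdl (\<iota> p) \<longleftrightarrow> \<iota> k \<in> PIdl (\<iota> p)"
      using M.a_rcos_const M.a_rcos_self nat_image_closed by metis
    then show ?thesis using nat_image_in_p_multiples[of k] by (simp add: FactRing_def)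
  qed
  ultimately show ?thesis
    unfolding has_char_def nat_image_def[symmetric] by simp
qed

theorem is_unramified_dvr: "unramified_dvr p R"
proof -
  have "principal_domain R"
    by (intro principal_domain.intro is_domain principal_domain_axioms.intro ideal_is_principal)
  moreover have "\<not> field R"
    using field.field_Units[of R] p_not_unit p_power_nonzero[of 1] by auto
  ultimately show ?thesis
    using maximal_iff has_char_0 residue_has_char
    by (auto simp: unramified_dvr_def mixed_char_dvr_def discrete_valuation_ring_def
        uniformizer_def simp flip: nat_image_def)
qed

end

section \<open>The p-adic completion\<close>

context p_adic_cring begin

text \<open>The ideals \<open>p\<^sup>nR\<close>. Computations in the completion are done with representing sequences of
  ring elements: \<open>coset_seq a\<close> is the point of the inverse limit that the compatible sequence \<open>a\<close>
  represents.\<close>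

abbreviation p_ideal :: "nat \<Rightarrow> 'a set" where "p_ideal n \<equiv> PIdl (\<iota> (p ^ n))"

abbreviation completion (\<open>V\<close>) where "V \<equiv> p_completion R p"

definition coset_seq :: "(nat \<Rightarrow> 'a) \<Rightarrow> nat \<Rightarrow> 'a set" where
  "coset_seq a = (\<lambda>n. p_ideal n +> a n)"

definition compatible :: "(nat \<Rightarrow> 'a) \<Rightarrow> bool" where
  "compatible a \<longleftrightarrow> (\<forall>n. a n \<in> carrier R) \<and> (\<forall>n. p_ideal n +> a (Suc n) = p_ideal n +> a n)"

lemma p_ideal_is_ideal: "ideal (p_ideal n) R"
  by (simp add: cgenideal_ideal)

lemma p_ideal_iff: "x \<in> p_ideal n \<longleftrightarrow> (\<exists>z\<in>carrier R. x = \<iota> (p ^ n) \<otimes> z)"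
  unfolding cgenideal_def by (auto simp: m_comm)

lemma p_ideal_0: "p_ideal 0 = carrier R"
  using p_ideal_iff[of _ 0] by auto

lemma p_ideal_mult:
  assumes "x \<in> p_ideal m" "y \<in> p_ideal n" shows "x \<otimes> y \<in> p_ideal (m + n)"
proof -
  obtain v w where vw: "v \<in> carrier R" "x = \<iota> (p ^ m) \<otimes> v" "w \<in> carrier R" "y = \<iota> (p ^ n) \<otimes> w"
    using assms p_ideal_iff by meson
  then have "x \<otimes> y = \<iota> (p ^ (m + n)) \<otimes> (v \<otimes> w)"
    by (simp add: nat_image_mult power_add m_ac)
  then show ?thesis using vw p_ideal_iff by blast
qed

lemma p_ideal_antimono: assumes "m \<le> n" shows "p_ideal n \<subseteq> p_ideal m"
proof
  fix x assume "x \<in> p_ideal n"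
  then obtain z where z: "z \<in> carrier R" "x = \<iota> (p ^ n) \<otimes> z" using p_ideal_iff by blast
  have "\<iota> (p ^ n) = \<iota> (p ^ m) \<otimes> \<iota> (p ^ (n - m))"
    using assms by (simp flip: nat_image_mult power_add)
  then have "x = \<iota> (p ^ m) \<otimes> (\<iota> (p ^ (n - m)) \<otimes> z)"
    using z by (simp add: m_assoc)
  then show "x \<in> p_ideal m" using z p_ideal_iff by blast
qed

lemma coset_eq_iff:
  assumes "a \<in> carrier R" "b \<in> carrier R"
  shows "p_ideal n +> a = p_ideal n +> b \<longleftrightarrow> a \<ominus> b \<in> p_ideal n"
  using quotient_eq_iff_same_a_r_cos[OF p_ideal_is_ideal assms] by simp

lemma coset_eq_self_iff:
  assumes "a \<in> carrier R" shows "p_ideal n +> a = p_ideal n +> \<zero> \<longleftrightarrow> a \<in> p_ideal n"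
  using coset_eq_iff[OF assms zero_closed] assms by (simp add: minus_eq)

lemma coset_add:
  "\<lbrakk>a \<in> carrier R; b \<in> carrier R\<rbrakk> \<Longrightarrow>
     (p_ideal n +> a) \<oplus>\<^bsub>R Quot p_ideal n\<^esub> (p_ideal n +> b) = p_ideal n +> (a \<oplus> b)"
  using ring_hom_add[OF ideal.rcos_ring_hom[OF p_ideal_is_ideal]] by metis

lemma coset_mult:
  "\<lbrakk>a \<in> carrier R; b \<in> carrier R\<rbrakk> \<Longrightarrow>
     (p_ideal n +> a) \<otimes>\<^bsub>R Quot p_ideal n\<^esub> (p_ideal n +> b) = p_ideal n +> (a \<otimes> b)"
  using ring_hom_mult[OF ideal.rcos_ring_hom[OF p_ideal_is_ideal]] by metis

lemma coset_antimono:
  assumes "m \<le> n" "a \<in> carrier R" "b \<in> carrier R" "p_ideal n +> a = p_ideal n +> b"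
  shows "p_ideal m +> a = p_ideal m +> b"
  using assms p_ideal_antimono coset_eq_iff by blast

lemma compatibleI:
  assumes "\<And>n. a n \<in> carrier R" "\<And>n. a (Suc n) \<ominus> a n \<in> p_ideal n" shows "compatible a"
  using assms coset_eq_iff by (simp add: compatible_def)

lemma compatible_closed: "compatible a \<Longrightarrow> a n \<in> carrier R"
  by (simp add: compatible_def)

lemma compatible_diff: "compatible a \<Longrightarrow> a (Suc n) \<ominus> a n \<in> p_ideal n"
  by (simp add: compatible_def flip: coset_eq_iff)

text \<open>Compatibility relates only neighbouring entries; by induction, \<open>a n\<close> determines all the earlier
  cosets.\<close>

lemma compatible_le:
  assumes "compatible a" "m \<le> n" shows "p_ideal m +> a n = p_ideal m +> a m"
  using assms(2)
proof (induction n rule: dec_induct)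
  case (step n)
  have "p_ideal m +> a (Suc n) = p_ideal m +> a n"
    using coset_antimono[OF step.hyps(1)] assms(1) by (simp add: compatible_def)
  then show ?case using step by simp
qed simp

lemma compatible_const: "x \<in> carrier R \<Longrightarrow> compatible (\<lambda>_. x)"
  by (simp add: compatible_def)

lemma compatible_add:
  assumes "compatible a" "compatible b" shows "compatible (\<lambda>n. a n \<oplus> b n)"
  using assms coset_add unfolding compatible_def by (metis a_closed)

lemma compatible_mult:
  assumes "compatible a" "compatible b" shows "compatible (\<lambda>n. a n \<otimes> b n)"
  using assms coset_mult unfolding compatible_def by (metis m_closed)

lemma compatible_a_inv:
  assumes "compatible a" shows "compatible (\<lambda>n. \<ominus> a n)"
proof (rule compatibleI)
  note [simp] = compatible_closed[OF assms]
  fix n show "\<ominus> a n \<in> carrier R" by simp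
  interpret I: ideal "p_ideal n" R by (rule p_ideal_is_ideal)
  have "a (Suc n) \<ominus> a n \<in> p_ideal n" by (rule compatible_diff[OF assms])
  moreover have "\<ominus> a (Suc n) \<ominus> \<ominus> a n = \<ominus> (a (Suc n) \<ominus> a n)"
    by (simp add: minus_eq minus_add)
  ultimately show "\<ominus> a (Suc n) \<ominus> \<ominus> a n \<in> p_ideal n" by simp
qed

text \<open>The inclusions \<open>s (n + 1) \<subseteq> s n\<close> between cosets say that a representative of the later coset also
  represents the earlier one.\<close>

lemma completion_carrier: "s \<in> carrier V \<longleftrightarrow> (\<exists>a. compatible a \<and> s = coset_seq a)"
proof
  have V: "s \<in> carrier V \<longleftrightarrow> (\<forall>n. s n \<in> a_rcosets (p_ideal n)) \<and> (\<forall>n. s (Suc n) \<subseteq> s n)" for s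
    by (simp add: p_completion_def FactRing_def nat_image_def)
  {
    assume s: "s \<in> carrier V"
    then have "\<forall>n. \<exists>x\<in>carrier R. s n = p_ideal n +> x" unfolding V A_RCOSETS_def' by auto
    then obtain a where a: "\<And>n. a n \<in> carrier R" "\<And>n. s n = p_ideal n +> a n" by metis
    have "p_ideal n +> a (Suc n) = p_ideal n +> a n" for n
    proof -
      interpret I: ideal "p_ideal (Suc n)" R by (rule p_ideal_is_ideal)
      have "a (Suc n) \<in> p_ideal (Suc n) +> a (Suc n)" using I.a_rcos_self a(1) by blast
      then have "a (Suc n) \<in> p_ideal n +> a n" using s a(2) unfolding V by auto
      then show ?thesis
        using a_repr_independence[of "a (Suc n)" "p_ideal n" "a n"] a(1)
          additive_subgroup.a_subgroup[OF ideal.axioms(1)[OF p_ideal_is_ideal]] by simp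
    qed
    then have "compatible a" using a by (simp add: compatible_def)
    then show "\<exists>a. compatible a \<and> s = coset_seq a"
      using a(2) by (intro exI[of _ a]) (auto simp: coset_seq_def)
  }
  assume "\<exists>a. compatible a \<and> s = coset_seq a"
  then obtain a where a: "compatible a" "s = coset_seq a" by blast
  have "p_ideal (Suc n) +> a (Suc n) \<subseteq> p_ideal n +> a n" for n
  proof -
    have "p_ideal (Suc n) +> a (Suc n) \<subseteq> p_ideal n +> a (Suc n)"
      using p_ideal_antimono[of n "Suc n"] by (auto simp: a_r_coset_def')
    then show ?thesis using a by (simp add: compatible_def)
  qed
  then show "s \<in> carrier V"
    unfolding V a(2) coset_seq_def using a(1) compatible_closed A_RCOSETS_def' by fastforce
qed

lemma coset_seq_closed: "compatible a \<Longrightarrow> coset_seq a \<in> carrier V"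
  using completion_carrier by blast

lemma completion_add:
  assumes "compatible a" "compatible b"
  shows "coset_seq a \<oplus>\<^bsub>V\<^esub> coset_seq b = coset_seq (\<lambda>n. a n \<oplus> b n)"
  using assms coset_add compatible_closed
  by (simp add: p_completion_def coset_seq_def nat_image_def fun_eq_iff)

lemma completion_mult:
  assumes "compatible a" "compatible b"
  shows "coset_seq a \<otimes>\<^bsub>V\<^esub> coset_seq b = coset_seq (\<lambda>n. a n \<otimes> b n)"
  using assms coset_mult compatible_closed
  by (simp add: p_completion_def coset_seq_def nat_image_def fun_eq_iff)

lemma completion_zero: "\<zero>\<^bsub>V\<^esub> = coset_seq (\<lambda>_. \<zero>)"
  using coset_eq_self_iff[OF zero_closed] ideal.rcos_ring_hom[OF p_ideal_is_ideal]
    ring_hom_zero[OF ideal.rcos_ring_hom[OF p_ideal_is_ideal] ring_axioms ideal.quotient_is_ring[OF p_ideal_is_ideal]]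
  by (simp add: p_completion_def coset_seq_def nat_image_def fun_eq_iff)

lemma completion_one: "\<one>\<^bsub>V\<^esub> = coset_seq (\<lambda>_. \<one>)"
  by (simp add: p_completion_def coset_seq_def nat_image_def fun_eq_iff FactRing_def)

lemmas completion_simps =
  completion_add completion_mult completion_zero completion_one coset_seq_closed
  compatible_add compatible_mult compatible_a_inv compatible_const compatible_closed

lemma completion_cring: "cring V"
proof (rule cringI)
  show "abelian_group V"
  proof (rule abelian_groupI)
    fix x assume "x \<in> carrier V"
    then obtain a where a: "compatible a" "x = coset_seq a" using completion_carrier by blast
    then show "\<exists>y\<in>carrier V. y \<oplus>\<^bsub>V\<^esub> x = \<zero>\<^bsub>V\<^esub>"
      by (intro bexI[of _ "coset_seq (\<lambda>n. \<ominus> a n)"]) (simp_all add: completion_simps l_neg)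
  qed (auto simp: completion_simps a_ac dest!: completion_carrier[THEN iffD1])
  show "comm_monoid V"
    by (rule comm_monoidI) (auto simp: completion_simps m_ac dest!: completion_carrier[THEN iffD1])
qed (auto simp: completion_simps l_distr dest!: completion_carrier[THEN iffD1])

lemma to_completion_eq: "to_p_completion R p x = coset_seq (\<lambda>_. x)"
  by (simp add: to_p_completion_def coset_seq_def nat_image_def)

lemma to_completion_hom: "to_p_completion R p \<in> ring_hom R V"
  by (rule ring_hom_memI) (simp_all add: to_completion_eq completion_simps)

lemma to_completion_nat_image: "nat_image V k = to_p_completion R p (\<iota> k)"
proof -
  interpret V: cring V by (rule completion_cring)
  show ?thesis
    by (induction k) (simp_all add: V.nat_image_Suc nat_image_Suc to_completion_eq completion_simps)
qed

end

context p_uniformized_ring begin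

text \<open>Cancelling \<open>p\<^sup>m\<close> costs exactly \<open>m\<close> levels of the \<open>p\<close>-adic filtration.\<close>

lemma p_power_times_in_p_ideal:
  assumes "u \<in> carrier R" "\<iota> (p ^ m) \<otimes> u \<in> p_ideal (m + n)" shows "u \<in> p_ideal n"
proof -
  obtain z where z: "z \<in> carrier R" "\<iota> (p ^ m) \<otimes> u = \<iota> (p ^ (m + n)) \<otimes> z"
    using assms p_ideal_iff by blast
  then have "\<iota> (p ^ m) \<otimes> u = \<iota> (p ^ m) \<otimes> (\<iota> (p ^ n) \<otimes> z)"
    by (simp add: power_add nat_image_mult m_assoc)
  then have "u = \<iota> (p ^ n) \<otimes> z"
    using m_lcancel[of "\<iota> (p ^ m)" u "\<iota> (p ^ n) \<otimes> z"] p_power_nonzero assms z by simp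
  then show ?thesis using z p_ideal_iff by blast
qed

lemma unit_not_in_p_ideal: assumes "u \<in> Units R" shows "\<iota> (p ^ n) \<otimes> u \<notin> p_ideal (Suc n)"
  using p_power_times_in_p_ideal[of u n 1] unit_not_p_multiple[OF assms] assms Units_closed by auto

text \<open>A nonzero \<open>p\<^sup>n u\<close> with \<open>u\<close> a unit does not survive in \<open>p\<^sup>n\<^sup>+\<^sup>1R\<close>, so that the ring is
  \<open>p\<close>-adically separated.\<close>

lemma to_completion_inj:
  assumes "x \<in> carrier R" "to_p_completion R p x = \<zero>\<^bsub>V\<^esub>" shows "x = \<zero>"
proof (rule ccontr)
  assume "x \<noteq> \<zero>"
  then obtain n u where u: "u \<in> Units R" "x = \<iota> (p ^ n) \<otimes> u" using p_power_factor assms by blast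
  have "p_ideal (Suc n) +> x = p_ideal (Suc n) +> \<zero>"
    using assms(2) by (metis to_completion_eq completion_zero coset_seq_def)
  then have "x \<in> p_ideal (Suc n)" using coset_eq_self_iff assms(1) by blast
  then show False using u unit_not_in_p_ideal by blast
qed

text \<open>The inverses form a compatible sequence, since \<open>1/a' - 1/a = -(a' - a)/(a a')\<close>.\<close>

lemma coset_seq_unit:
  assumes "compatible a" "\<And>n. a n \<in> Units R" shows "coset_seq a \<in> Units V"
proof -
  interpret V: cring V by (rule completion_cring)
  have "compatible (\<lambda>n. inv a n)"
  proof (rule compatibleI)
    fix n
    show "inv a n \<in> carrier R" using assms by simp
    interpret I: ideal "p_ideal n" R by (rule p_ideal_is_ideal)
    have carr: "a n \<in> carrier R" "a (Suc n) \<in> carrier R" "inv (a n) \<in> carrier R" "inv (a (Suc n)) \<in> carrier R"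
      using assms Units_closed by auto
    have "a (Suc n) \<ominus> a n \<in> p_ideal n" by (rule compatible_diff[OF assms(1)])
    then have "\<ominus> (inv a n \<otimes> inv a (Suc n) \<otimes> (a (Suc n) \<ominus> a n)) \<in> p_ideal n"
      using carr by (simp add: I.I_l_closed)
    moreover have "x' \<ominus> x = \<ominus> (x \<otimes> x' \<otimes> (y' \<ominus> y))"
      if "x \<in> carrier R" "x' \<in> carrier R" "y \<in> carrier R" "y' \<in> carrier R" "x \<otimes> y = \<one>" "x' \<otimes> y' = \<one>"
      for x x' y y'
    proof -
      have "\<ominus> (x \<otimes> x' \<otimes> (y' \<ominus> y)) = (x \<otimes> y) \<otimes> x' \<ominus> x \<otimes> (x' \<otimes> y')"
        using that(1-4) by algebra
      then show ?thesis using that by simp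
    qed
    then have "inv a (Suc n) \<ominus> inv a n = \<ominus> (inv a n \<otimes> inv a (Suc n) \<otimes> (a (Suc n) \<ominus> a n))"
      using carr assms by simp
    ultimately show "inv a (Suc n) \<ominus> inv a n \<in> p_ideal n" by simp
  qed
  then have "coset_seq a \<otimes>\<^bsub>V\<^esub> coset_seq (\<lambda>n. inv a n) = \<one>\<^bsub>V\<^esub>" "coset_seq (\<lambda>n. inv a n) \<in> carrier V"
    using assms by (simp_all add: completion_simps)
  then show ?thesis using V.m_comm[of "coset_seq a"] coset_seq_closed[OF assms(1)]
    unfolding Units_def by fastforce
qed

text \<open>If \<open>m\<close> is maximal with \<open>s\<close> trivial modulo \<open>p\<^sup>m\<close>, then all entries \<open>a k\<close> with \<open>k > m\<close> of a representing
  sequence are exactly divisible by \<open>p\<^sup>m\<close>. The quotients are units of the base ring, and shifted by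
  \<open>m + 1\<close> places they form a compatible sequence.\<close>

lemma completion_p_power_factor:
  assumes s: "s \<in> carrier V" "s \<noteq> \<zero>\<^bsub>V\<^esub>"
  shows "\<exists>m. \<exists>u\<in>Units V. s = nat_image V (p ^ m) \<otimes>\<^bsub>V\<^esub> u"
proof -
  obtain a where a: "compatible a" "s = coset_seq a" using completion_carrier s by blast
  note carr [simp] = compatible_closed[OF a(1)]
  have "\<exists>n. a n \<notin> p_ideal n"
  proof (rule ccontr)
    assume "\<nexists>n. a n \<notin> p_ideal n"
    then have "s = \<zero>\<^bsub>V\<^esub>" unfolding a completion_zero coset_seq_def
      using coset_eq_self_iff carr by (intro ext) simp
    then show False using s by simp
  qed
  then have ex: "\<exists>n. a n \<notin> p_ideal n \<and> (\<forall>k<n. a k \<in> p_ideal k)"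
    using exists_least_iff[of "\<lambda>n. a n \<notin> p_ideal n"] by auto
  then obtain k where k: "a k \<notin> p_ideal k" "\<And>i. i < k \<Longrightarrow> a i \<in> p_ideal i" by blast
  then have "k \<noteq> 0" using p_ideal_0 by (metis carr)
  then obtain m where m: "k = Suc m" by (cases k) auto
  have "\<exists>u\<in>Units R. a (Suc m + n) = \<iota> (p ^ m) \<otimes> u" for n
  proof -
    have "p_ideal m +> a (Suc m + n) = p_ideal m +> \<zero>"
      using compatible_le[OF a(1), of m "Suc m + n"] k(2)[of m] m coset_eq_self_iff by simp
    then have "a (Suc m + n) \<in> p_ideal m" using coset_eq_self_iff by simp
    then obtain u where u: "u \<in> carrier R" "a (Suc m + n) = \<iota> (p ^ m) \<otimes> u" using p_ideal_iff by blast
    have "a (Suc m + n) \<notin> p_ideal (Suc m)"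
      using compatible_le[OF a(1), of "Suc m" "Suc m + n"] k(1) m coset_eq_self_iff carr
      by (metis le_add1)
    then have "u \<notin> p_ideal 1" using u p_ideal_mult[of "\<iota> (p ^ m)" m u 1] cgenideal_self by auto
    then show ?thesis using u unit_iff_not_p_multiple by auto
  qed
  then obtain u where u: "\<And>n. u n \<in> Units R" "\<And>n. a (Suc m + n) = \<iota> (p ^ m) \<otimes> u n" by metis
  note uc [simp] = Units_closed[OF u(1)]
  have comp: "compatible u"
  proof (rule compatibleI)
    fix n
    have "a (Suc m + Suc n) \<ominus> a (Suc m + n) \<in> p_ideal (Suc m + n)"
      using compatible_diff[OF a(1), of "Suc m + n"] by simp
    moreover have "x \<otimes> (y \<ominus> z) = x \<otimes> y \<ominus> x \<otimes> z"
      if "x \<in> carrier R" "y \<in> carrier R" "z \<in> carrier R" for x y z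
      using that by algebra
    then have "\<iota> (p ^ m) \<otimes> (u (Suc n) \<ominus> u n) = a (Suc m + Suc n) \<ominus> a (Suc m + n)"
      unfolding u(2) by (metis nat_image_closed uc)
    ultimately have "\<iota> (p ^ m) \<otimes> (u (Suc n) \<ominus> u n) \<in> p_ideal (m + Suc n)"
      by (simp only: add_Suc_shift)
    then have "u (Suc n) \<ominus> u n \<in> p_ideal (Suc n)" 
      by (rule p_power_times_in_p_ideal[OF minus_closed[OF uc uc]])
    then show "u (Suc n) \<ominus> u n \<in> p_ideal n"
      by (rule subsetD[OF p_ideal_antimono[OF le_SucI[OF order_refl]]])
  qed simp
  have "s = nat_image V (p ^ m) \<otimes>\<^bsub>V\<^esub> coset_seq u"
  proof -
    have "nat_image V (p ^ m) \<otimes>\<^bsub>V\<^esub> coset_seq u = coset_seq (\<lambda>n. a (Suc m + n))"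
      using comp by (simp only: to_completion_nat_image to_completion_eq completion_simps nat_image_closed u(2))
    also have "\<dots> = s" unfolding a(2) coset_seq_def
      by (intro ext compatible_le[OF a(1)] le_add2)
    finally show ?thesis by simp
  qed
  then show ?thesis using coset_seq_unit[OF comp u(1)] by blast
qed

theorem completion_p_uniformized: "p_uniformized_ring V p"
proof (intro p_uniformized_ring.intro p_adic_cring.intro completion_cring p_uniformized_ring_axioms.intro)
  interpret V: cring V by (rule completion_cring)
  show "normalization_semidom_class.prime p" by (rule prime_p)
  show "nat_image V p \<notin> Units V"
  proof
    assume "nat_image V p \<in> Units V"
    then obtain t where t: "t \<in> carrier V" "nat_image V p \<otimes>\<^bsub>V\<^esub> t = \<one>\<^bsub>V\<^esub>" by (auto simp: Units_def)
    obtain a where a: "compatible a" "t = coset_seq a" using completion_carrier t by blast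
    have "coset_seq (\<lambda>n. \<iota> p \<otimes> a n) = coset_seq (\<lambda>_. \<one>)"
      using t a by (simp add: to_completion_nat_image to_completion_eq completion_simps)
    then have eq: "p_ideal 1 +> (\<iota> p \<otimes> a 1) = p_ideal 1 +> \<one>" unfolding coset_seq_def by metis
    have "\<iota> p \<otimes> a 1 \<in> p_ideal 1" using p_ideal_iff[of _ 1] compatible_closed[OF a(1)] by auto
    then have "\<one> \<in> p_ideal 1" using eq coset_eq_self_iff compatible_closed[OF a(1)]
      by (metis m_closed nat_image_closed one_closed)
    then show False using unit_not_p_multiple[of \<one>] by simp
  qed
  show "nat_image V (p ^ n) \<noteq> \<zero>\<^bsub>V\<^esub>" for n
    using to_completion_inj[of "\<iota> (p ^ n)"] p_power_nonzero to_completion_nat_image by auto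
qed (rule completion_p_power_factor)

text \<open>The iteration \<open>x \<mapsto> pc - x\<^sup>2\<close> keeps multiples of \<open>p\<close>, and there it is a contraction: two
  successive differences are related by the factor \<open>-(x' + x)\<close>, a multiple of \<open>p\<close>. The limit is a
  fixed point, that is, a root of \<open>u\<^sup>2 + u = pc\<close>.\<close>

lemma completion_quadratic_root:
  assumes c: "c \<in> carrier R"
  shows "\<exists>u\<in>carrier V. u \<otimes>\<^bsub>V\<^esub> u \<oplus>\<^bsub>V\<^esub> u = to_p_completion R p (\<iota> p \<otimes> c)"
proof -
  define f where "f = rec_nat \<zero> (\<lambda>_ x. \<iota> p \<otimes> c \<ominus> x \<otimes> x)"
  have f0: "f 0 = \<zero>" and fS: "f (Suc n) = \<iota> p \<otimes> c \<ominus> f n \<otimes> f n" for n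
    by (simp_all add: f_def)
  interpret I: ideal "p_ideal 1" R by (rule p_ideal_is_ideal)
  have f1: "f n \<in> p_ideal 1" for n
  proof (induction n)
    case (Suc n)
    have "\<iota> p \<otimes> c \<in> p_ideal 1" using p_ideal_iff[of _ 1] c by auto
    moreover have "\<ominus> (f n \<otimes> f n) \<in> p_ideal 1" using Suc I.I_l_closed I.a_Hcarr by blast
    ultimately show ?case unfolding fS minus_eq by (rule I.a_closed)
  qed (use f0 I.zero_closed in simp)
  have carr [simp]: "f n \<in> carrier R" for n using f1 I.a_Hcarr by blast
  have step: "f (Suc n) \<ominus> f n \<in> p_ideal n" for n
  proof (induction n)
    case (Suc n)
    have "x \<ominus> b \<otimes> b \<ominus> (x \<ominus> a \<otimes> a) = \<ominus> ((b \<ominus> a) \<otimes> (b \<oplus> a))"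
      if "x \<in> carrier R" "a \<in> carrier R" "b \<in> carrier R" for x a b
      using that by algebra
    then have "f (Suc (Suc n)) \<ominus> f (Suc n) = \<ominus> ((f (Suc n) \<ominus> f n) \<otimes> (f (Suc n) \<oplus> f n))"
      using c fS[of "Suc n"] fS[of n] by simp
    moreover have "(f (Suc n) \<ominus> f n) \<otimes> (f (Suc n) \<oplus> f n) \<in> p_ideal (n + 1)"
      using Suc f1 by (intro p_ideal_mult I.a_closed)
    ultimately show ?case
      using additive_subgroup.a_inv_closed[OF ideal.axioms(1)[OF p_ideal_is_ideal]]
      by (metis Suc_eq_plus1)
  qed (use p_ideal_0 in simp)
  then have comp: "compatible f" by (intro compatibleI) simp_all
  have "coset_seq (\<lambda>n. f n \<otimes> f n \<oplus> f n) = coset_seq (\<lambda>_. \<iota> p \<otimes> c)"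
    unfolding coset_seq_def
  proof
    fix n
    have "x \<ominus> (x \<ominus> a \<otimes> a \<ominus> a) = a \<otimes> a \<oplus> a"
      if "x \<in> carrier R" "a \<in> carrier R" for x a
      using that by algebra
    then have "\<iota> p \<otimes> c \<ominus> (f n \<otimes> f n \<oplus> f n) = f (Suc n) \<ominus> f n"
      unfolding fS using c by (simp add: minus_eq minus_add a_ac)
    then have "\<iota> p \<otimes> c \<ominus> (f n \<otimes> f n \<oplus> f n) \<in> p_ideal n" using step by simp
    then show "p_ideal n +> (f n \<otimes> f n \<oplus> f n) = p_ideal n +> \<iota> p \<otimes> c"
      using coset_eq_iff[of "\<iota> p \<otimes> c" "f n \<otimes> f n \<oplus> f n" n] c by simp
  qed
  then show ?thesis
    using comp c by (intro bexI[of _ "coset_seq f"]) (simp_all add: to_completion_eq completion_simps)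
qed

end

section \<open>Fraction fields\<close>

context domain begin

lemma frac_class_mem:
  assumes "a \<in> carrier R" "b \<in> carrier R - {\<zero>}"
  shows "(c, d) \<in> frac_class R a b \<longleftrightarrow> c \<in> carrier R \<and> d \<in> carrier R - {\<zero>} \<and> a \<otimes> d = c \<otimes> b"
  using assms by (auto simp: frac_class_def frac_rel_def)

lemma frac_class_subset:
  assumes "a \<in> carrier R" "b \<in> carrier R - {\<zero>}" "c \<in> carrier R" "d \<in> carrier R - {\<zero>}"
    "a \<otimes> d = c \<otimes> b"
  shows "frac_class R a b \<subseteq> frac_class R c d"
proof
  fix z assume "z \<in> frac_class R a b"
  then obtain e f where z: "z = (e, f)" "e \<in> carrier R" "f \<in> carrier R - {\<zero>}" "a \<otimes> f = e \<otimes> b"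
    using frac_class_mem assms by (cases z) auto
  have "b \<otimes> (c \<otimes> f) = (c \<otimes> b) \<otimes> f" using assms z by (simp add: m_ac)
  also have "\<dots> = (a \<otimes> d) \<otimes> f" using assms by simp
  also have "\<dots> = (a \<otimes> f) \<otimes> d" using assms(1,2,4) z(2,3) by (simp add: m_ac)
  also have "\<dots> = (e \<otimes> b) \<otimes> d" using z by simp
  also have "\<dots> = b \<otimes> (e \<otimes> d)" using assms(1,2,4) z(2,3) by (simp add: m_ac)
  finally have "c \<otimes> f = e \<otimes> d" using assms z m_lcancel[of b "c \<otimes> f" "e \<otimes> d"] by simp
  then show "z \<in> frac_class R c d" using frac_class_mem assms z by simp
qed

lemma frac_class_eq_iff:
  assumes "a \<in> carrier R" "b \<in> carrier R - {\<zero>}" "c \<in> carrier R" "d \<in> carrier R - {\<zero>}"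
  shows "frac_class R a b = frac_class R c d \<longleftrightarrow> a \<otimes> d = c \<otimes> b"
proof
  assume "frac_class R a b = frac_class R c d"
  moreover have "(a, b) \<in> frac_class R a b" using assms frac_class_mem by simp
  ultimately show "a \<otimes> d = c \<otimes> b" using frac_class_mem[of c d a b] assms by simp
qed (use assms frac_class_subset[of a b c d] frac_class_subset[of c d a b] in auto)

abbreviation frac_field (\<open>Frac\<close>) where "Frac \<equiv> fraction_field R"

lemma frac_carrier:
  "C \<in> carrier Frac \<longleftrightarrow>
     (\<exists>a b. a \<in> carrier R \<and> b \<in> carrier R - {\<zero>} \<and> C = frac_class R a b)"
  by (auto simp: fraction_field_def quotient_def frac_class_def)

text \<open>The operations of the fraction field are unions over all representatives. This lemma reduces
  them to one choice of representatives, given that the united class does not depend on the choice.\<close>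

lemma frac_UN_eq:
  assumes a: "a \<in> carrier R" "b \<in> carrier R - {\<zero>}" "c \<in> carrier R" "d \<in> carrier R - {\<zero>}"
    and same: "\<And>a' b' c' d'. \<lbrakk>a' \<in> carrier R; b' \<in> carrier R - {\<zero>}; c' \<in> carrier R;
       d' \<in> carrier R - {\<zero>}; a \<otimes> b' = a' \<otimes> b; c \<otimes> d' = c' \<otimes> d\<rbrakk> \<Longrightarrow> f a' b' c' d' = f a b c d"
  shows "(\<Union>(a', b')\<in>frac_class R a b. \<Union>(c', d')\<in>frac_class R c d. f a' b' c' d') = f a b c d"
proof -
  have "f a' b' c' d' = f a b c d"
    if "(a', b') \<in> frac_class R a b" "(c', d') \<in> frac_class R c d" for a' b' c' d'
    using that same by (simp add: frac_class_mem[OF a(1,2)] frac_class_mem[OF a(3,4)])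
  moreover have "(a, b) \<in> frac_class R a b" "(c, d) \<in> frac_class R c d"
    using a frac_class_mem by auto
  ultimately show ?thesis by blast
qed

lemma frac_mult:
  assumes "a \<in> carrier R" "b \<in> carrier R - {\<zero>}" "c \<in> carrier R" "d \<in> carrier R - {\<zero>}"
  shows "frac_class R a b \<otimes>\<^bsub>Frac\<^esub> frac_class R c d = frac_class R (a \<otimes> c) (b \<otimes> d)"
proof -
  have "frac_class R (a' \<otimes> c') (b' \<otimes> d') = frac_class R (a \<otimes> c) (b \<otimes> d)"
    if h: "a' \<in> carrier R" "b' \<in> carrier R - {\<zero>}" "c' \<in> carrier R" "d' \<in> carrier R - {\<zero>}"
      "a \<otimes> b' = a' \<otimes> b" "c \<otimes> d' = c' \<otimes> d" for a' b' c' d'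
  proof -
    have "(a' \<otimes> c') \<otimes> (b \<otimes> d) = (a' \<otimes> b) \<otimes> (c' \<otimes> d)" using assms h by (simp add: m_ac)
    also have "\<dots> = (a \<otimes> b') \<otimes> (c \<otimes> d')" using h by simp
    also have "\<dots> = (a \<otimes> c) \<otimes> (b' \<otimes> d')" using assms h(1-4) by (simp add: m_ac)
    finally show ?thesis using assms h by (subst frac_class_eq_iff) (auto simp: integral_iff)
  qed
  then show ?thesis
    using frac_UN_eq[OF assms, of "\<lambda>a b c d. frac_class R (a \<otimes> c) (b \<otimes> d)"]
    by (simp add: fraction_field_def)
qed

lemma frac_add:
  assumes "a \<in> carrier R" "b \<in> carrier R - {\<zero>}" "c \<in> carrier R" "d \<in> carrier R - {\<zero>}"
  shows "frac_class R a b \<oplus>\<^bsub>Frac\<^esub> frac_class R c d = frac_class R (a \<otimes> d \<oplus> c \<otimes> b) (b \<otimes> d)"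
proof -
  have "frac_class R (a' \<otimes> d' \<oplus> c' \<otimes> b') (b' \<otimes> d') = frac_class R (a \<otimes> d \<oplus> c \<otimes> b) (b \<otimes> d)"
    if h: "a' \<in> carrier R" "b' \<in> carrier R - {\<zero>}" "c' \<in> carrier R" "d' \<in> carrier R - {\<zero>}"
      "a \<otimes> b' = a' \<otimes> b" "c \<otimes> d' = c' \<otimes> d" for a' b' c' d'
  proof -
    have carr: "b \<in> carrier R" "d \<in> carrier R" "b' \<in> carrier R" "d' \<in> carrier R"
      using assms h by auto
    have "(a' \<otimes> d' \<oplus> c' \<otimes> b') \<otimes> (b \<otimes> d) = (a' \<otimes> b) \<otimes> (d \<otimes> d') \<oplus> (c' \<otimes> d) \<otimes> (b \<otimes> b')"
      using assms(1,3) h(1,3) carr by algebra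
    also have "\<dots> = (a \<otimes> b') \<otimes> (d \<otimes> d') \<oplus> (c \<otimes> d') \<otimes> (b \<otimes> b')" using h by simp
    also have "\<dots> = (a \<otimes> d \<oplus> c \<otimes> b) \<otimes> (b' \<otimes> d')"
      using assms(1,3) carr by algebra
    finally show ?thesis using assms h by (subst frac_class_eq_iff) (auto simp: integral_iff)
  qed
  then show ?thesis
    using frac_UN_eq[OF assms, of "\<lambda>a b c d. frac_class R (a \<otimes> d \<oplus> c \<otimes> b) (b \<otimes> d)"]
    by (simp add: fraction_field_def)
qed

lemma frac_zero: "\<zero>\<^bsub>Frac\<^esub> = frac_class R \<zero> \<one>" and frac_one: "\<one>\<^bsub>Frac\<^esub> = frac_class R \<one> \<one>"
  by (simp_all add: fraction_field_def)

lemma frac_cases: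
  assumes "x \<in> carrier Frac"
  obtains a b where "a \<in> carrier R" "b \<in> carrier R" "b \<noteq> \<zero>" "x = frac_class R a b"
  using assms frac_carrier by auto

lemma frac_closed: "\<lbrakk>a \<in> carrier R; b \<in> carrier R; b \<noteq> \<zero>\<rbrakk> \<Longrightarrow> frac_class R a b \<in> carrier Frac"
  using frac_carrier by auto

lemmas frac_simps = frac_mult frac_add frac_zero frac_one frac_closed integral_iff frac_class_eq_iff

lemma frac_cring: "cring Frac"
proof (rule cringI)
  show "abelian_group Frac"
  proof (rule abelian_groupI)
    fix x y assume "x \<in> carrier Frac" "y \<in> carrier Frac"
    then obtain a b c d where ab: "a \<in> carrier R" "b \<in> carrier R" "b \<noteq> \<zero>" "x = frac_class R a b"
      and cd: "c \<in> carrier R" "d \<in> carrier R" "d \<noteq> \<zero>" "y = frac_class R c d"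
      by (metis frac_cases)
    show "x \<oplus>\<^bsub>Frac\<^esub> y \<in> carrier Frac" using ab cd by (simp add: frac_simps)
    show "x \<oplus>\<^bsub>Frac\<^esub> y = y \<oplus>\<^bsub>Frac\<^esub> x"
      using ab cd by (simp add: frac_simps) (use ab(1,2) cd(1,2) in algebra)
    show "\<zero>\<^bsub>Frac\<^esub> \<oplus>\<^bsub>Frac\<^esub> x = x" using ab by (simp add: frac_simps)
    show "\<exists>y\<in>carrier Frac. y \<oplus>\<^bsub>Frac\<^esub> x = \<zero>\<^bsub>Frac\<^esub>"
      using ab by (intro bexI[of _ "frac_class R (\<ominus> a) b"]) (simp_all add: frac_simps l_minus l_neg)
    fix z assume "z \<in> carrier Frac"
    then obtain e f where ef: "e \<in> carrier R" "f \<in> carrier R" "f \<noteq> \<zero>" "z = frac_class R e f"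
      by (metis frac_cases)
    show "x \<oplus>\<^bsub>Frac\<^esub> y \<oplus>\<^bsub>Frac\<^esub> z = x \<oplus>\<^bsub>Frac\<^esub> (y \<oplus>\<^bsub>Frac\<^esub> z)"
      using ab cd ef by (simp add: frac_simps) (use ab(1,2) cd(1,2) ef(1,2) in algebra)
  qed (simp add: frac_simps)
  show "comm_monoid Frac"
  proof (rule comm_monoidI)
    fix x y assume "x \<in> carrier Frac" "y \<in> carrier Frac"
    then obtain a b c d where ab: "a \<in> carrier R" "b \<in> carrier R" "b \<noteq> \<zero>" "x = frac_class R a b"
      and cd: "c \<in> carrier R" "d \<in> carrier R" "d \<noteq> \<zero>" "y = frac_class R c d"
      by (metis frac_cases)
    show "x \<otimes>\<^bsub>Frac\<^esub> y \<in> carrier Frac" using ab cd by (simp add: frac_simps)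
    show "x \<otimes>\<^bsub>Frac\<^esub> y = y \<otimes>\<^bsub>Frac\<^esub> x" using ab cd by (simp add: frac_simps m_ac)
    show "\<one>\<^bsub>Frac\<^esub> \<otimes>\<^bsub>Frac\<^esub> x = x" using ab by (simp add: frac_simps)
    fix z assume "z \<in> carrier Frac"
    then obtain e f where ef: "e \<in> carrier R" "f \<in> carrier R" "f \<noteq> \<zero>" "z = frac_class R e f"
      by (metis frac_cases)
    show "x \<otimes>\<^bsub>Frac\<^esub> y \<otimes>\<^bsub>Frac\<^esub> z = x \<otimes>\<^bsub>Frac\<^esub> (y \<otimes>\<^bsub>Frac\<^esub> z)"
      using ab cd ef by (simp add: frac_simps m_ac)
  qed (simp add: frac_simps)
  fix x y z assume "x \<in> carrier Frac" "y \<in> carrier Frac" "z \<in> carrier Frac"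
  then obtain a b c d e f where ab: "a \<in> carrier R" "b \<in> carrier R" "b \<noteq> \<zero>" "x = frac_class R a b"
    and cd: "c \<in> carrier R" "d \<in> carrier R" "d \<noteq> \<zero>" "y = frac_class R c d"
    and ef: "e \<in> carrier R" "f \<in> carrier R" "f \<noteq> \<zero>" "z = frac_class R e f"
    by (metis frac_cases)
  show "(x \<oplus>\<^bsub>Frac\<^esub> y) \<otimes>\<^bsub>Frac\<^esub> z = x \<otimes>\<^bsub>Frac\<^esub> z \<oplus>\<^bsub>Frac\<^esub> y \<otimes>\<^bsub>Frac\<^esub> z"
    using ab cd ef by (simp add: frac_simps) (use ab(1,2) cd(1,2) ef(1,2) in algebra)
qed

lemma frac_field: "field Frac"
proof (rule cring.cring_fieldI2[OF frac_cring])
  show "\<zero>\<^bsub>Frac\<^esub> \<noteq> \<one>\<^bsub>Frac\<^esub>" by (simp add: frac_simps)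
  fix x assume x: "x \<in> carrier Frac" "x \<noteq> \<zero>\<^bsub>Frac\<^esub>"
  then obtain a b where ab: "a \<in> carrier R" "b \<in> carrier R" "b \<noteq> \<zero>" "x = frac_class R a b"
    by (metis frac_cases)
  have "a \<noteq> \<zero>" using x ab by (auto simp: frac_simps)
  then show "\<exists>y\<in>carrier Frac. x \<otimes>\<^bsub>Frac\<^esub> y = \<one>\<^bsub>Frac\<^esub>"
    using ab by (intro bexI[of _ "frac_class R b a"]) (simp_all add: frac_simps m_comm)
qed

lemma to_frac_hom: "to_fraction_field R \<in> ring_hom R Frac"
  by (rule ring_hom_memI) (simp_all add: to_fraction_field_def frac_simps)

lemma to_frac_inj: "inj_on (to_fraction_field R) (carrier R)"
  by (rule inj_onI) (simp add: to_fraction_field_def frac_simps)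

lemma frac_class_eq_quotient:
  assumes "a \<in> carrier R" "b \<in> carrier R" "b \<noteq> \<zero>"
  shows "frac_class R a b = to_fraction_field R a \<otimes>\<^bsub>Frac\<^esub> inv\<^bsub>Frac\<^esub> to_fraction_field R b"
proof -
  interpret F: field Frac by (rule frac_field)
  have j: "to_fraction_field R a \<in> carrier Frac" "to_fraction_field R b \<in> carrier Frac"
    using assms to_frac_hom ring_hom_closed by metis+
  have "to_fraction_field R b \<noteq> \<zero>\<^bsub>Frac\<^esub>"
    using assms by (simp add: to_fraction_field_def frac_simps)
  then have u: "to_fraction_field R b \<in> Units Frac" using j F.field_Units by simp
  have "frac_class R a b \<otimes>\<^bsub>Frac\<^esub> to_fraction_field R b = to_fraction_field R a"
    using assms by (simp add: to_fraction_field_def frac_simps)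
  then have "to_fraction_field R a \<otimes>\<^bsub>Frac\<^esub> inv\<^bsub>Frac\<^esub> to_fraction_field R b =
      frac_class R a b \<otimes>\<^bsub>Frac\<^esub> (to_fraction_field R b \<otimes>\<^bsub>Frac\<^esub> inv\<^bsub>Frac\<^esub> to_fraction_field R b)"
    using assms j u by (metis F.Units_inv_closed F.m_assoc frac_closed)
  then show ?thesis using u assms frac_closed by simp
qed

lemma fraction_field_map_frac_class:
  assumes S: "domain S" and h: "h \<in> ring_hom R S" "inj_on h (carrier R)"
    and a: "a \<in> carrier R" "b \<in> carrier R" "b \<noteq> \<zero>"
  shows "fraction_field_map S h (frac_class R a b) = frac_class S (h a) (h b)"
proof -
  interpret S: domain S by (rule S)
  have nz: "h x \<noteq> \<zero>\<^bsub>S\<^esub>" if "x \<in> carrier R" "x \<noteq> \<zero>" for x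
    using that h ring_hom_zero[OF h(1) ring_axioms S.ring_axioms] by (metis inj_onD zero_closed)
  have same: "frac_class S (h c) (h d) = frac_class S (h a) (h b)"
    if "c \<in> carrier R" "d \<in> carrier R" "d \<noteq> \<zero>" "a \<otimes> d = c \<otimes> b" for c d
  proof (subst S.frac_class_eq_iff)
    show "h c \<otimes>\<^bsub>S\<^esub> h b = h a \<otimes>\<^bsub>S\<^esub> h d" using that a h by (metis ring_hom_mult)
  qed (use that a nz ring_hom_closed[OF h(1)] in auto)
  have "(case z of (c, d) \<Rightarrow> frac_class S (h c) (h d)) = frac_class S (h a) (h b)"
    if "z \<in> frac_class R a b" for z
  proof (cases z)
    case (Pair c d)
    then show ?thesis using that same[of c d] a by (simp add: frac_class_mem)
  qed
  moreover have "(a, b) \<in> frac_class R a b" using a frac_class_mem by simp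
  ultimately show ?thesis
    unfolding fraction_field_map_def by (intro SUP_eq_const) auto
qed

end

text \<open>Membership of a field element \<open>x\<close> is always shown by exhibiting a denominator \<open>b\<close> with
  \<open>x b\<close> in the subring, which avoids computing with inverses of products.\<close>

lemma (in field) subring_fractions_subfield:
  assumes B: "subring B R"
  shows "subfield {a \<otimes> inv b | a b. a \<in> B \<and> b \<in> B \<and> b \<noteq> \<zero>} R" (is "subfield ?L R")
proof (rule subfieldI')
  note BE = subringE[OF B]
  have L: "\<exists>a b. a \<in> carrier R \<and> b \<in> Units R \<and> a \<in> B \<and> b \<in> B \<and> x = a \<otimes> inv b" if "x \<in> ?L" for x
    using that BE(1) field_Units by blast
  have LI: "x \<in> ?L" if "x \<in> carrier R" "x \<otimes> b = a" "a \<in> B" "b \<in> B" "b \<noteq> \<zero>" for x a b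
  proof -
    have "b \<in> Units R" using that BE(1) field_Units by auto
    then have "x = a \<otimes> inv b" using that BE(1) by (auto simp: m_assoc Units_closed)
    then show ?thesis using that by blast
  qed
  have nz: "b \<noteq> \<zero>" if "b \<in> Units R" for b using that by (simp add: field_Units)
  show "subring ?L R"
  proof (rule subringI)
    show "?L \<subseteq> carrier R" using L by fastforce
    show "\<one> \<in> ?L" by (rule LI[of _ \<one> \<one>]) (use BE in auto)
  next
    fix x assume "x \<in> ?L"
    then obtain a b where a: "a \<in> carrier R" "b \<in> Units R" "a \<in> B" "b \<in> B" "x = a \<otimes> inv b"
      using L by blast
    have "\<ominus> x \<otimes> b = \<ominus> a" using a by (simp add: l_minus m_assoc Units_closed)
    then show "\<ominus> x \<in> ?L"
      by (intro LI[of _ b "\<ominus> a"]) (use a BE(5) nz in simp_all)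
  next
    fix x y assume "x \<in> ?L" "y \<in> ?L"
    then obtain a b c d where a: "a \<in> carrier R" "b \<in> Units R" "a \<in> B" "b \<in> B" "x = a \<otimes> inv b"
      and c: "c \<in> carrier R" "d \<in> Units R" "c \<in> B" "d \<in> B" "y = c \<otimes> inv d"
      using L[of x] L[of y] by blast
    have bd: "b \<otimes> d \<noteq> \<zero>" "b \<otimes> d \<in> B"
      using a c nz BE(6) by (simp_all add: integral_iff Units_closed)
    have carr: "b \<in> carrier R" "d \<in> carrier R" "inv b \<in> carrier R" "inv d \<in> carrier R"
      using a c by (auto simp: Units_closed)
    have "(a \<otimes> inv b) \<otimes> (c \<otimes> inv d) \<otimes> (b \<otimes> d) = (a \<otimes> c) \<otimes> (inv b \<otimes> b) \<otimes> (inv d \<otimes> d)"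
      using a(1) c(1) carr by algebra
    then show "x \<otimes> y \<in> ?L"
      by (intro LI[of _ "b \<otimes> d" "a \<otimes> c"]) (use a c bd carr BE(6) in simp_all)
    have "(a \<otimes> inv b \<oplus> c \<otimes> inv d) \<otimes> (b \<otimes> d)
        = a \<otimes> (inv b \<otimes> b) \<otimes> d \<oplus> c \<otimes> (inv d \<otimes> d) \<otimes> b"
      using a(1) c(1) carr by algebra
    then show "x \<oplus> y \<in> ?L"
      by (intro LI[of _ "b \<otimes> d" "a \<otimes> d \<oplus> c \<otimes> b"]) (use a c bd carr BE(6,7) in simp_all)
  qed
  fix x assume x: "x \<in> ?L - {\<zero>}"
  then obtain a b where a: "a \<in> carrier R" "b \<in> Units R" "a \<in> B" "b \<in> B" "x = a \<otimes> inv b"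
    using L by blast
  have x': "x \<in> Units R" using x a field_Units by auto
  have "a \<noteq> \<zero>" using x a by auto
  moreover have "x \<otimes> b = a" using a by (simp add: m_assoc Units_closed)
  then have "inv x \<otimes> a = b" using x' a by (metis Units_inv_closed Units_l_inv Units_closed l_one m_assoc)
  ultimately show "inv x \<in> ?L"
    by (intro LI[of _ a b]) (use x' a in simp_all)
qed

section \<open>Intersections with subfields of the fraction field\<close>

lemma nat_image_carrier_update: "nat_image (R\<lparr>carrier := H\<rparr>) n = nat_image R n"
  by (simp add: nat_image_def add_pow_def nat_pow_def)

text \<open>If \<open>x = p\<^sup>n u\<close> lies in the subfield then so do \<open>u = x / p\<^sup>n\<close> and \<open>1 / u\<close>, because a subfield contains
  the integers and is closed under inverses. The factorization therefore takes place within the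
  intersection.\<close>

lemma (in p_uniformized_ring) subfield_inter_p_uniformized:
  assumes K: "field K" and h: "h \<in> ring_hom R K" "inj_on h (carrier R)" and F: "subfield F K"
  shows "p_uniformized_ring (K\<lparr>carrier := F \<inter> h ` carrier R\<rparr>) p" (is "p_uniformized_ring ?S p")
proof -
  interpret K: field K by (rule K)
  interpret h: ring_hom_ring R K h
    by (rule ring_hom_ringI2[OF ring_axioms K.ring_axioms h(1)])
  note FE = subringE[OF subfieldE(1)[OF F]]
  have sub: "subring (F \<inter> h ` carrier R) K"
    by (rule K.subring_inter[OF subfieldE(1)[OF F] h.img_is_subring[OF carrier_is_subring]])
  have "cring ?S"
    using K.subcring_iff[OF subringE(1)[OF sub]] K.subcringI'[OF sub] by blast
  then interpret S: cring ?S .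
  have hnat: "nat_image K n = h (\<iota> n)" for n
    by (induction n) (simp_all add: K.nat_image_Suc nat_image_Suc)
  have natF: "nat_image K n \<in> F" for n
    by (induction n) (use FE in \<open>simp_all add: K.nat_image_Suc\<close>)
  have hinj: "h x = h y \<Longrightarrow> x = y" if "x \<in> carrier R" "y \<in> carrier R" for x y
    using h(2) that by (auto dest: inj_onD)
  show ?thesis
  proof (intro p_uniformized_ring.intro p_adic_cring.intro S.cring_axioms p_uniformized_ring_axioms.intro)
    show "normalization_semidom_class.prime p" by (rule prime_p)
    show "nat_image ?S p \<notin> Units ?S"
    proof
      assume "nat_image ?S p \<in> Units ?S"
      then obtain v where v: "v \<in> carrier R" "h (\<iota> p) \<otimes>\<^bsub>K\<^esub> h v = \<one>\<^bsub>K\<^esub>"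
        unfolding Units_def by (auto simp: nat_image_carrier_update hnat)
      then have "\<iota> p \<otimes> v = \<one>" using hinj[of "\<iota> p \<otimes> v" \<one>] by simp
      then show False using v p_not_unit m_comm[of v "\<iota> p"] unfolding Units_def by auto
    qed
    show "nat_image ?S (p ^ n) \<noteq> \<zero>\<^bsub>?S\<^esub>" for n
      using hinj[of "\<iota> (p ^ n)" \<zero>] p_power_nonzero by (auto simp: nat_image_carrier_update hnat)
    fix x assume x: "x \<in> carrier ?S" "x \<noteq> \<zero>\<^bsub>?S\<^esub>"
    then obtain s where s: "s \<in> carrier R" "x = h s" "x \<in> F" by auto
    have "s \<noteq> \<zero>" using x s by auto
    then obtain n u where u: "u \<in> Units R" "s = \<iota> (p ^ n) \<otimes> u" using p_power_factor s by blast
    have hu: "h u \<otimes>\<^bsub>K\<^esub> h (inv u) = \<one>\<^bsub>K\<^esub>" "h u \<in> carrier K" "h (inv u) \<in> carrier K"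
      using u by (simp_all add: Units_closed flip: h.hom_mult)
    have hu0: "h u \<noteq> \<zero>\<^bsub>K\<^esub>" using hu by auto
    have pi: "h (\<iota> (p ^ n)) \<noteq> \<zero>\<^bsub>K\<^esub>" using hinj[of "\<iota> (p ^ n)" \<zero>] p_power_nonzero by auto
    have x_eq: "x = h (\<iota> (p ^ n)) \<otimes>\<^bsub>K\<^esub> h u" using s u by (simp add: Units_closed)
    have "inv\<^bsub>K\<^esub> h (\<iota> (p ^ n)) \<otimes>\<^bsub>K\<^esub> x = h u"
      unfolding x_eq using pi hu K.field_Units by (simp flip: K.m_assoc)
    moreover have "inv\<^bsub>K\<^esub> h (\<iota> (p ^ n)) \<in> F"
      using K.subfield_m_inv(1)[OF F, of "h (\<iota> (p ^ n))"] natF[of "p ^ n"] pi hnat by simp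
    ultimately have uF: "h u \<in> F" using FE(6) s by metis
    have "inv\<^bsub>K\<^esub> h u = h (inv u)"
      using hu by (metis K.comm_inv_char)
    then have "h (inv u) \<in> F" using K.subfield_m_inv(1)[OF F, of "h u"] uF hu0 by simp
    then have "h u \<in> Units ?S"
      unfolding Units_def using uF hu u K.m_comm[of "h u" "h (inv u)"] by (auto simp: Units_closed)
    then show "\<exists>n. \<exists>u\<in>Units ?S. x = nat_image ?S (p ^ n) \<otimes>\<^bsub>?S\<^esub> u"
      using x_eq by (auto simp: nat_image_carrier_update hnat)
  qed
qed

section \<open>The Eisenstein integers localized at 2\<close>

abbreviation Zloc :: "rat ring" where "Zloc \<equiv> int_localization 2"

lemma Zloc_carrier: "x \<in> carrier Zloc \<longleftrightarrow> (\<exists>a b :: int. odd b \<and> x = of_int a / of_int b)"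
  by (auto simp: int_localization_def)

lemma Zloc_ops [simp]:
  "x \<otimes>\<^bsub>Zloc\<^esub> y = x * y" "x \<oplus>\<^bsub>Zloc\<^esub> y = x + y" "\<one>\<^bsub>Zloc\<^esub> = 1" "\<zero>\<^bsub>Zloc\<^esub> = 0"
  by (simp_all add: int_localization_def)

lemma Zloc_add: assumes "x \<in> carrier Zloc" "y \<in> carrier Zloc" shows "x + y \<in> carrier Zloc"
proof -
  obtain a b c d :: int where "odd b" "x = of_int a / of_int b" "odd d" "y = of_int c / of_int d"
    using assms Zloc_carrier by metis
  moreover from this have "b \<noteq> 0" "d \<noteq> 0" by auto
  ultimately have "odd (b * d)" "x + y = of_int (a * d + c * b) / of_int (b * d)"
    by (auto simp: add_frac_eq)
  then show ?thesis using Zloc_carrier by blast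
qed

lemma Zloc_mult: assumes "x \<in> carrier Zloc" "y \<in> carrier Zloc" shows "x * y \<in> carrier Zloc"
proof -
  obtain a b c d :: int where "odd b" "x = of_int a / of_int b" "odd d" "y = of_int c / of_int d"
    using assms Zloc_carrier by metis
  then have "odd (b * d)" "x * y = of_int (a * c) / of_int (b * d)" by auto
  then show ?thesis using Zloc_carrier by blast
qed

lemma Zloc_of_int: "of_int a \<in> carrier Zloc"
  using Zloc_carrier by (metis div_by_1 of_int_1 odd_one)

lemma Zloc_numeral [simp]: "0 \<in> carrier Zloc" "1 \<in> carrier Zloc" "numeral n \<in> carrier Zloc"
  "- numeral n \<in> carrier Zloc" "- 1 \<in> carrier Zloc" "of_nat k \<in> carrier Zloc"
  using Zloc_of_int[of 0] Zloc_of_int[of 1] Zloc_of_int[of "numeral n"] Zloc_of_int[of "- numeral n"]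
    Zloc_of_int[of "- 1"] Zloc_of_int[of "int k"] by simp_all

lemma Zloc_uminus: "x \<in> carrier Zloc \<Longrightarrow> - x \<in> carrier Zloc"
  using Zloc_mult[of "- 1" x] by simp

lemma Zloc_diff: "\<lbrakk>x \<in> carrier Zloc; y \<in> carrier Zloc\<rbrakk> \<Longrightarrow> x - y \<in> carrier Zloc"
  using Zloc_add[of x "- y"] Zloc_uminus by simp

lemmas Zloc_closed [simp] = Zloc_add Zloc_mult Zloc_uminus Zloc_diff

lemma half_not_in_Zloc: "1 / 2 \<notin> carrier Zloc"
proof
  assume "1 / 2 \<in> carrier Zloc"
  then obtain a b :: int where ab: "odd b" "1 / 2 = (of_int a / of_int b :: rat)" using Zloc_carrier by blast
  then have "b \<noteq> 0" by auto
  then have "of_int b = (of_int (2 * a) :: rat)" using ab by (simp add: field_simps)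
  then show False using ab(1) by (simp only: of_int_eq_iff) simp
qed

lemma Zloc_domain: "domain Zloc"
proof (rule domainI)
  show "cring Zloc"
  proof (rule cringI)
    show "abelian_group Zloc"
      by (rule abelian_groupI) (auto intro: bexI[of _ "- x" for x])
    show "comm_monoid Zloc" by (rule comm_monoidI) auto
  qed (simp add: distrib_right)
qed auto

interpretation Zloc: domain Zloc by (rule Zloc_domain)

abbreviation Zloc_X :: "rat list ring" where "Zloc_X \<equiv> poly_ring Zloc"

interpretation Zloc_X: domain Zloc_X
  by (rule Zloc.univ_poly_is_domain[OF Zloc.carrier_is_subring])

abbreviation cyclotomic_ideal :: "rat list set" where "cyclotomic_ideal \<equiv> PIdl\<^bsub>Zloc_X\<^esub> [1, 1, 1]"

lemma cyclotomic_closed: "[1, 1, 1] \<in> carrier Zloc_X"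
  by (simp add: polynomial_def flip: univ_poly_carrier)

lemma cyclotomic_is_ideal: "ideal cyclotomic_ideal Zloc_X"
  by (rule Zloc_X.cgenideal_ideal[OF cyclotomic_closed])

lemma ring_A_eq: "ring_A = Zloc_X Quot cyclotomic_ideal"
  by (simp add: ring_A_def Let_def)

interpretation A: cring ring_A
  unfolding ring_A_eq by (rule ideal.quotient_is_cring[OF cyclotomic_is_ideal Zloc_X.is_cring])

definition A_const :: "rat \<Rightarrow> rat list set" where
  "A_const a = cyclotomic_ideal +>\<^bsub>Zloc_X\<^esub> Zloc.poly_of_const a"

definition omega :: "rat list set" (\<open>\<omega>\<close>) where "\<omega> = cyclotomic_ideal +>\<^bsub>Zloc_X\<^esub> [1, 0]"

text \<open>The coordinates of \<open>\<rat>(\<omega>)\<close>, in which an equation in \<open>A\<close> becomes a pair of rational equations.\<close>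

definition eis :: "rat \<Rightarrow> rat \<Rightarrow> rat list set" where
  "eis a b = A_const a \<oplus>\<^bsub>ring_A\<^esub> A_const b \<otimes>\<^bsub>ring_A\<^esub> \<omega>"

lemma X_closed: "[1, 0] \<in> carrier Zloc_X"
  by (simp add: polynomial_def flip: univ_poly_carrier)

lemma coset_hom: "(+>\<^bsub>Zloc_X\<^esub>) cyclotomic_ideal \<in> ring_hom Zloc_X ring_A"
  unfolding ring_A_eq by (rule ideal.rcos_ring_hom[OF cyclotomic_is_ideal])

lemma const_hom: "Zloc.poly_of_const \<in> ring_hom Zloc Zloc_X"
  using Zloc.canonical_embedding_is_hom[OF Zloc.carrier_is_subring] by simp

lemma A_const_hom: "A_const \<in> ring_hom Zloc ring_A"
proof -
  have "A_const = (+>\<^bsub>Zloc_X\<^esub>) cyclotomic_ideal \<circ> Zloc.poly_of_const" by (simp add: A_const_def fun_eq_iff)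
  then show ?thesis using ring_hom_trans[OF const_hom coset_hom] by simp
qed

lemma linear_poly:
  assumes "a \<in> carrier Zloc" "b \<in> carrier Zloc"
  shows "Zloc.poly_of_const a \<oplus>\<^bsub>Zloc_X\<^esub> Zloc.poly_of_const b \<otimes>\<^bsub>Zloc_X\<^esub> [1, 0] = Zloc.normalize [b, a]"
proof -
  have "Zloc.poly_of_const b \<otimes>\<^bsub>Zloc_X\<^esub> [1, 0] = (if b = 0 then [] else [b, 0])"
    using Zloc.poly_mult_var[OF Zloc.carrier_is_subring, of "Zloc.poly_of_const b"] assms
      ring_hom_closed[OF const_hom, of b]
    by (simp add: Zloc.poly_of_const_def var_def)
  then show ?thesis
    by (simp add: univ_poly_add Zloc.poly_of_const_def)
qed

lemma eis_coset:
  assumes "a \<in> carrier Zloc" "b \<in> carrier Zloc"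
  shows "eis a b = cyclotomic_ideal +>\<^bsub>Zloc_X\<^esub> Zloc.normalize [b, a]"
proof -
  have "Zloc.poly_of_const a \<in> carrier Zloc_X" "Zloc.poly_of_const b \<in> carrier Zloc_X"
    using assms ring_hom_closed[OF const_hom] by simp_all
  then show ?thesis
    unfolding linear_poly[OF assms, symmetric] eis_def A_const_def omega_def
    using X_closed by (simp only: ring_hom_add[OF coset_hom] ring_hom_mult[OF coset_hom] Zloc_X.m_closed)
qed

text \<open>A nonzero multiple of the monic polynomial \<open>x\<^sup>2 + x + 1\<close> has degree at least 2.\<close>

lemma eis_eq_zero:
  assumes "a \<in> carrier Zloc" "b \<in> carrier Zloc" "eis a b = \<zero>\<^bsub>ring_A\<^esub>"
  shows "a = 0 \<and> b = 0"
proof -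
  interpret cyc: ideal cyclotomic_ideal Zloc_X by (rule cyclotomic_is_ideal)
  have norm: "Zloc.normalize [b, a] \<in> carrier Zloc_X"
    using assms Zloc.normalize_gives_polynomial[of "[b, a]" "carrier Zloc"] by (simp add: univ_poly_carrier)
  have "cyclotomic_ideal +>\<^bsub>Zloc_X\<^esub> Zloc.normalize [b, a] = cyclotomic_ideal"
    using assms eis_coset by (simp add: ring_A_eq FactRing_def)
  then have "Zloc.normalize [b, a] \<in> cyclotomic_ideal" using cyc.a_rcos_self[OF norm] by simp
  then obtain g where g: "g \<in> carrier Zloc_X" "Zloc.normalize [b, a] = g \<otimes>\<^bsub>Zloc_X\<^esub> [1, 1, 1]"
    unfolding cgenideal_def by blast
  have "g = []"
  proof (rule ccontr)
    assume "g \<noteq> []"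
    then have "length g \<ge> 1" by (cases g) simp_all
    then have "degree (g \<otimes>\<^bsub>Zloc_X\<^esub> [1, 1, 1]) \<ge> 2"
      using Zloc.poly_mult_degree_eq[OF Zloc.carrier_is_subring, of g "[1, 1, 1]"] g cyclotomic_closed \<open>g \<noteq> []\<close>
      by (simp add: univ_poly_mult univ_poly_carrier)
    moreover have "length (Zloc.normalize [b, a]) \<le> 2"
      using Zloc.normalize_length_le[of "[b, a]"] by simp
    ultimately show False using g by simp
  qed
  then have "Zloc.normalize [b, a] = []"
    using g Zloc_X.l_null[OF cyclotomic_closed] by (simp add: univ_poly_zero)
  then show ?thesis by (simp split: if_splits)
qed

text \<open>Division with remainder by \<open>x\<^sup>2 + x + 1\<close> works over any ring of coefficients, because its
  leading coefficient is a unit.\<close>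

lemma eis_surj:
  assumes "x \<in> carrier ring_A"
  shows "\<exists>a\<in>carrier Zloc. \<exists>b\<in>carrier Zloc. x = eis a b"
proof -
  interpret cyc: ideal cyclotomic_ideal Zloc_X by (rule cyclotomic_is_ideal)
  obtain f where f: "f \<in> carrier Zloc_X" "x = cyclotomic_ideal +>\<^bsub>Zloc_X\<^esub> f"
    using assms unfolding ring_A_eq FactRing_def A_RCOSETS_def' by auto
  obtain q r where qr: "q \<in> carrier Zloc_X" "r \<in> carrier Zloc_X"
    "f = [1, 1, 1] \<otimes>\<^bsub>Zloc_X\<^esub> q \<oplus>\<^bsub>Zloc_X\<^esub> r" "r = [] \<or> degree r < 2"
    using Zloc.long_division_theorem[OF Zloc.carrier_is_subring, of f "[1, 1, 1]"] f cyclotomic_closed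
      Zloc.Units_one_closed
    by (auto simp: univ_poly_carrier)
  have "x = cyclotomic_ideal +>\<^bsub>Zloc_X\<^esub> r"
  proof -
    have "[1, 1, 1] \<otimes>\<^bsub>Zloc_X\<^esub> q \<in> cyclotomic_ideal"
      using cyc.I_r_closed[OF Zloc_X.cgenideal_self[OF cyclotomic_closed] qr(1)] .
    then have "f \<ominus>\<^bsub>Zloc_X\<^esub> r \<in> cyclotomic_ideal"
      using qr cyclotomic_closed by (simp add: Zloc_X.minus_eq Zloc_X.a_assoc Zloc_X.r_neg)
    then show ?thesis
      using Zloc_X.quotient_eq_iff_same_a_r_cos[OF cyc.ideal_axioms f(1) qr(2)] f by simp
  qed
  moreover have "\<exists>a\<in>carrier Zloc. \<exists>b\<in>carrier Zloc. r = Zloc.normalize [b, a]"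
  proof -
    have pr: "polynomial\<^bsub>Zloc\<^esub> (carrier Zloc) r" using qr by (simp add: univ_poly_carrier)
    have "length r \<le> 2" using qr(4) by auto
    then consider "r = []" | a where "r = [a]" | b a where "r = [b, a]"
      by (cases r; cases "tl r") auto
    then show ?thesis
    proof cases
      case 1
      then show ?thesis by (intro bexI[of _ 0]) simp_all
    next
      case (2 a)
      then show ?thesis using pr by (intro bexI[of _ a] bexI[of _ 0]) (simp_all add: polynomial_def)
    next
      case (3 b a)
      then show ?thesis using pr by (intro bexI[of _ a] bexI[of _ b]) (simp_all add: polynomial_def)
    qed
  qed
  ultimately show ?thesis using eis_coset by metis
qed

lemma omega_closed [simp]: "\<omega> \<in> carrier ring_A"
  using ring_hom_closed[OF coset_hom X_closed] by (simp add: omega_def)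

lemma A_const_closed [simp]: "a \<in> carrier Zloc \<Longrightarrow> A_const a \<in> carrier ring_A"
  by (rule ring_hom_closed[OF A_const_hom])

lemma omega_root: "\<omega> \<otimes>\<^bsub>ring_A\<^esub> \<omega> \<oplus>\<^bsub>ring_A\<^esub> \<omega> \<oplus>\<^bsub>ring_A\<^esub> \<one>\<^bsub>ring_A\<^esub> = \<zero>\<^bsub>ring_A\<^esub>"
proof -
  interpret cyc: ideal cyclotomic_ideal Zloc_X by (rule cyclotomic_is_ideal)
  have XX: "[1, 0] \<otimes>\<^bsub>Zloc_X\<^esub> [1, 0] = [1, 0, 0]"
    using Zloc.poly_mult_var[OF Zloc.carrier_is_subring X_closed] by (simp add: var_def)
  have "[1, 0] \<otimes>\<^bsub>Zloc_X\<^esub> [1, 0] \<oplus>\<^bsub>Zloc_X\<^esub> [1, 0] \<oplus>\<^bsub>Zloc_X\<^esub> \<one>\<^bsub>Zloc_X\<^esub> = [1, 1, 1]"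
    unfolding XX by (simp add: univ_poly_add univ_poly_one)
  moreover have "cyclotomic_ideal +>\<^bsub>Zloc_X\<^esub> [1, 1, 1] = \<zero>\<^bsub>ring_A\<^esub>"
    using cyc.a_rcos_const[OF Zloc_X.cgenideal_self[OF cyclotomic_closed]] by (simp add: ring_A_eq FactRing_def)
  ultimately show ?thesis
    using X_closed ring_hom_add[OF coset_hom] ring_hom_mult[OF coset_hom] ring_hom_one[OF coset_hom]
    unfolding omega_def by (metis Zloc_X.a_closed Zloc_X.m_closed Zloc_X.one_closed)
qed

lemma eis_closed [simp]: "\<lbrakk>a \<in> carrier Zloc; b \<in> carrier Zloc\<rbrakk> \<Longrightarrow> eis a b \<in> carrier ring_A"
  by (simp add: eis_def)

lemma A_const_simps:
  assumes "a \<in> carrier Zloc" "b \<in> carrier Zloc"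
  shows "A_const (a + b) = A_const a \<oplus>\<^bsub>ring_A\<^esub> A_const b" "A_const (a * b) = A_const a \<otimes>\<^bsub>ring_A\<^esub> A_const b"
    "A_const (a - b) = A_const a \<ominus>\<^bsub>ring_A\<^esub> A_const b"
proof -
  show add: "A_const (a + b) = A_const a \<oplus>\<^bsub>ring_A\<^esub> A_const b"
    using ring_hom_add[OF A_const_hom assms] by simp
  show "A_const (a * b) = A_const a \<otimes>\<^bsub>ring_A\<^esub> A_const b"
    using ring_hom_mult[OF A_const_hom assms] by simp
  have "A_const a = A_const (a - b) \<oplus>\<^bsub>ring_A\<^esub> A_const b"
    using ring_hom_add[OF A_const_hom, of "a - b" b] assms by simp
  then show "A_const (a - b) = A_const a \<ominus>\<^bsub>ring_A\<^esub> A_const b"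
    using assms by (simp add: A.minus_eq A.a_assoc A.r_neg)
qed

lemma A_const_0 [simp]: "A_const 0 = \<zero>\<^bsub>ring_A\<^esub>" and A_const_1 [simp]: "A_const 1 = \<one>\<^bsub>ring_A\<^esub>"
  using ring_hom_zero[OF A_const_hom Zloc.ring_axioms A.ring_axioms] ring_hom_one[OF A_const_hom] by simp_all

lemma eis_add:
  assumes "a \<in> carrier Zloc" "b \<in> carrier Zloc" "c \<in> carrier Zloc" "d \<in> carrier Zloc"
  shows "eis a b \<oplus>\<^bsub>ring_A\<^esub> eis c d = eis (a + c) (b + d)"
  using assms by (simp add: eis_def A_const_simps A.l_distr A.a_ac)

lemma eis_mult:
  assumes "a \<in> carrier Zloc" "b \<in> carrier Zloc" "c \<in> carrier Zloc" "d \<in> carrier Zloc"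
  shows "eis a b \<otimes>\<^bsub>ring_A\<^esub> eis c d = eis (a * c - b * d) (a * d + b * c - b * d)"
proof -
  have red: "(a \<oplus>\<^bsub>ring_A\<^esub> b \<otimes>\<^bsub>ring_A\<^esub> w) \<otimes>\<^bsub>ring_A\<^esub> (c \<oplus>\<^bsub>ring_A\<^esub> d \<otimes>\<^bsub>ring_A\<^esub> w)
    = ((a \<otimes>\<^bsub>ring_A\<^esub> c \<ominus>\<^bsub>ring_A\<^esub> b \<otimes>\<^bsub>ring_A\<^esub> d)
       \<oplus>\<^bsub>ring_A\<^esub> (a \<otimes>\<^bsub>ring_A\<^esub> d \<oplus>\<^bsub>ring_A\<^esub> b \<otimes>\<^bsub>ring_A\<^esub> c \<ominus>\<^bsub>ring_A\<^esub> b \<otimes>\<^bsub>ring_A\<^esub> d) \<otimes>\<^bsub>ring_A\<^esub> w)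
      \<oplus>\<^bsub>ring_A\<^esub> (b \<otimes>\<^bsub>ring_A\<^esub> d) \<otimes>\<^bsub>ring_A\<^esub> (w \<otimes>\<^bsub>ring_A\<^esub> w \<oplus>\<^bsub>ring_A\<^esub> w \<oplus>\<^bsub>ring_A\<^esub> \<one>\<^bsub>ring_A\<^esub>)"
    if "a \<in> carrier ring_A" "b \<in> carrier ring_A" "c \<in> carrier ring_A" "d \<in> carrier ring_A"
      "w \<in> carrier ring_A" for a b c d w
    using that A.one_closed by algebra
  show ?thesis
    unfolding eis_def using assms by (subst red) (simp_all add: omega_root A_const_simps)
qed

lemma eis_eq_iff:
  assumes "a \<in> carrier Zloc" "b \<in> carrier Zloc" "c \<in> carrier Zloc" "d \<in> carrier Zloc"
  shows "eis a b = eis c d \<longleftrightarrow> a = c \<and> b = d"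
proof
  assume "eis a b = eis c d"
  then have "eis (a - c) (b - d) \<oplus>\<^bsub>ring_A\<^esub> eis c d = eis c d"
    using assms by (simp add: eis_add)
  then have "eis (a - c) (b - d) = \<zero>\<^bsub>ring_A\<^esub>"
    using assms A.add.r_cancel_one by simp
  then show "a = c \<and> b = d" using eis_eq_zero[of "a - c" "b - d"] assms by simp
qed simp

lemma eis_one: "\<one>\<^bsub>ring_A\<^esub> = eis 1 0" and eis_zero: "\<zero>\<^bsub>ring_A\<^esub> = eis 0 0" and omega_eis: "\<omega> = eis 0 1"
  by (simp_all add: eis_def)

lemma nat_image_A: "nat_image ring_A n = eis (of_nat n) 0"
proof (induction n)
  case 0
  then show ?case by (simp add: eis_zero[symmetric])
next
  case (Suc n)
  then show ?case
    using eis_add[of "of_nat n" 0 1 0] by (simp add: A.nat_image_Suc eis_one add.commute)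
qed

text \<open>The norm \<open>(a + b\<omega>)(a + b\<omega>\<^sup>2)\<close>.\<close>

definition eis_norm :: "rat \<Rightarrow> rat \<Rightarrow> rat" where "eis_norm a b = a * a - a * b + b * b"

lemma eis_norm_mult: "eis_norm (a * c - b * d) (a * d + b * c - b * d) = eis_norm a b * eis_norm c d"
  by (simp add: eis_norm_def algebra_simps power2_eq_square)

text \<open>Four times the norm is \<open>(2a - b)\<^sup>2 + 3b\<^sup>2\<close>.\<close>

lemma eis_norm_eq_0: "eis_norm a b = 0 \<longleftrightarrow> a = 0 \<and> b = 0"
proof
  assume *: "eis_norm a b = 0"
  have "(2 * a - b)\<^sup>2 + 3 * b\<^sup>2 = 4 * eis_norm a b" by (simp add: eis_norm_def algebra_simps power2_eq_square)
  then have "(2 * a - b)\<^sup>2 + 3 * b\<^sup>2 = 0" using * by simp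
  moreover have "(2 * a - b)\<^sup>2 \<ge> 0" "b\<^sup>2 \<ge> 0" by simp_all
  ultimately have "b\<^sup>2 = 0" "(2 * a - b)\<^sup>2 = 0" by linarith+
  then show "a = 0 \<and> b = 0" by simp
qed (simp add: eis_norm_def)

text \<open>The conjugate \<open>a + b\<omega>\<^sup>2\<close> equals \<open>(a - b) - b\<omega>\<close>.\<close>

lemma eis_conj:
  assumes "a \<in> carrier Zloc" "b \<in> carrier Zloc"
  shows "eis a b \<otimes>\<^bsub>ring_A\<^esub> eis (a - b) (- b) = eis (eis_norm a b) 0"
  using assms by (simp add: eis_mult eis_norm_def algebra_simps)

text \<open>After clearing odd denominators and the common power of 2, the two coordinates are not both
  even. Their norm is then an odd integer, because \<open>x\<^sup>2 + x + 1\<close> has no root modulo 2: this is why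
  2 stays prime in \<open>A\<close>.\<close>

lemma primitive_pair:
  assumes "a \<in> carrier Zloc" "b \<in> carrier Zloc" "a \<noteq> 0 \<or> b \<noteq> 0"
  shows "\<exists>n. \<exists>c\<in>carrier Zloc. \<exists>d\<in>carrier Zloc. a = 2 ^ n * c \<and> b = 2 ^ n * d \<and> inverse (eis_norm c d) \<in> carrier Zloc"
proof -
  obtain x s y t :: int where st: "odd s" "a = of_int x / of_int s" "odd t" "b = of_int y / of_int t"
    using assms Zloc_carrier by metis
  define m where "m = s * t"
  have m: "odd m" "m \<noteq> 0" "a = of_int (x * t) / of_int m" "b = of_int (y * s) / of_int m"
    using st by (auto simp: m_def)
  let ?g = "gcd (x * t) (y * s)"
  have "x * t \<noteq> 0 \<or> y * s \<noteq> 0" using m assms(3) by auto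
  then have g0: "?g \<noteq> 0" by auto
  obtain k x0 y0 where k: "?g = 2 ^ multiplicity 2 ?g * k" "odd k"
    and xy: "x * t = x0 * ?g" "y * s = y0 * ?g" "coprime x0 y0"
  proof -
    have "\<exists>k. ?g = 2 ^ multiplicity 2 ?g * k \<and> odd k"
      by (rule multiplicity_decompose'[OF g0, of 2]) auto
    then show thesis using that gcd_coprime_exists[OF g0] by blast
  qed
  define n where "n = multiplicity 2 ?g"
  define c d where "c = k * x0" and "d = k * y0"
  have cd: "x * t = 2 ^ n * c" "y * s = 2 ^ n * d"
    using k(1) xy unfolding n_def c_def d_def by (metis mult.assoc mult.commute)+
  have "odd x0 \<or> odd y0" using xy(3) by (metis coprime_common_divisor odd_one)
  then have odd: "odd (c * c - c * d + d * d)" using k(2) unfolding c_def d_def by auto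
  define N where "N = c * c - c * d + d * d"
  have "eis_norm (of_int c / of_int m) (of_int d / of_int m) = of_int N / of_int (m * m)"
    using m(2) by (simp add: eis_norm_def N_def field_simps)
  then have "inverse (eis_norm (of_int c / of_int m) (of_int d / of_int m)) = of_int (m * m) / of_int N"
    by simp
  then have "inverse (eis_norm (of_int c / of_int m) (of_int d / of_int m)) \<in> carrier Zloc"
    using odd Zloc_carrier N_def by metis
  moreover have "a = 2 ^ n * (of_int c / of_int m)" "b = 2 ^ n * (of_int d / of_int m)"
    unfolding m(3,4) cd by simp_all
  moreover have "of_int c / of_int m \<in> carrier Zloc" "of_int d / of_int m \<in> carrier Zloc"
    using m(1) Zloc_carrier by blast+
  ultimately show ?thesis by metis
qed

theorem A_p_uniformized: "p_uniformized_ring ring_A 2"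
proof (intro p_uniformized_ring.intro p_adic_cring.intro A.is_cring p_uniformized_ring_axioms.intro)
  show "normalization_semidom_class.prime (2 :: nat)" by simp
  show "nat_image ring_A 2 \<notin> Units ring_A"
  proof
    assume "nat_image ring_A 2 \<in> Units ring_A"
    then obtain y where y: "y \<in> carrier ring_A" "nat_image ring_A 2 \<otimes>\<^bsub>ring_A\<^esub> y = \<one>\<^bsub>ring_A\<^esub>"
      unfolding Units_def by auto
    obtain a b where ab: "a \<in> carrier Zloc" "b \<in> carrier Zloc" "y = eis a b" using eis_surj y by blast
    then have "2 * a = 1" using y by (simp add: nat_image_A eis_mult eis_one eis_eq_iff)
    then have "a = 1 / 2" by simp
    then show False using half_not_in_Zloc ab by metis
  qed
  show "nat_image ring_A (2 ^ n) \<noteq> \<zero>\<^bsub>ring_A\<^esub>" for n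
    using Zloc_numeral(6)[of "2 ^ n"] by (simp add: nat_image_A eis_zero eis_eq_iff)
  fix x assume x: "x \<in> carrier ring_A" "x \<noteq> \<zero>\<^bsub>ring_A\<^esub>"
  then obtain a b where ab: "a \<in> carrier Zloc" "b \<in> carrier Zloc" "x = eis a b" using eis_surj by blast
  then have "a \<noteq> 0 \<or> b \<noteq> 0" using x eis_zero by auto
  then obtain n c d where cd: "c \<in> carrier Zloc" "d \<in> carrier Zloc" "a = 2 ^ n * c" "b = 2 ^ n * d"
    "inverse (eis_norm c d) \<in> carrier Zloc" using primitive_pair ab by blast
  define N where "N = eis_norm c d"
  have N: "N \<in> carrier Zloc" "inverse N \<in> carrier Zloc" using cd by (simp_all add: N_def eis_norm_def)
  have "c \<noteq> 0 \<or> d \<noteq> 0" using \<open>a \<noteq> 0 \<or> b \<noteq> 0\<close> cd by auto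
  then have "N \<noteq> 0" using eis_norm_eq_0 N_def by simp
  have "eis c d \<otimes>\<^bsub>ring_A\<^esub> (eis (c - d) (- d) \<otimes>\<^bsub>ring_A\<^esub> eis (inverse N) 0) = eis N 0 \<otimes>\<^bsub>ring_A\<^esub> eis (inverse N) 0"
    using cd N eis_conj by (simp flip: A.m_assoc add: N_def)
  also have "\<dots> = \<one>\<^bsub>ring_A\<^esub>" using N \<open>N \<noteq> 0\<close> by (simp add: eis_mult eis_one)
  finally have "eis c d \<in> Units ring_A"
    using cd N A.m_comm[of "eis c d" "eis (c - d) (- d) \<otimes>\<^bsub>ring_A\<^esub> eis (inverse N) 0"]
    unfolding Units_def by (intro CollectI conjI bexI[of _ "eis (c - d) (- d) \<otimes>\<^bsub>ring_A\<^esub> eis (inverse N) 0"]) simp_all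
  moreover have "x = nat_image ring_A (2 ^ n) \<otimes>\<^bsub>ring_A\<^esub> eis c d"
    using cd ab Zloc_numeral(6)[of "2 ^ n"] by (simp add: nat_image_A eis_mult)
  ultimately show "\<exists>n. \<exists>u\<in>Units ring_A. x = nat_image ring_A (2 ^ n) \<otimes>\<^bsub>ring_A\<^esub> u" by blast
qed

section \<open>Nonsquares among the Eisenstein numbers\<close>

lemma rat_square_ne_57: assumes "r\<^sup>2 = 57 * s\<^sup>2" shows "s = (0 :: rat)"
proof (rule ccontr)
  assume "s \<noteq> 0"
  obtain a b where ab: "quotient_of (r / s) = (a, b)" by force
  then have b: "b > 0" "coprime a b" and rs: "r / s = of_int a / of_int b"
    using quotient_of_denom_pos quotient_of_coprime quotient_of_div by blast+
  have "(of_int a)\<^sup>2 = (57 * (of_int b)\<^sup>2 :: rat)"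
  proof -
    have "of_int a = r / s * of_int b" using rs b(1) by simp
    then show ?thesis using assms \<open>s \<noteq> 0\<close> by (simp add: power_mult_distrib power_divide)
  qed
  then have eq: "a\<^sup>2 = 57 * b\<^sup>2" by (metis of_int_eq_iff of_int_mult of_int_numeral of_int_power)
  have p3: "prime_elem (3 :: int)" by simp
  have "a\<^sup>2 = 3 * (19 * b\<^sup>2)" using eq by simp
  then have "3 dvd a\<^sup>2" by (rule dvdI)
  then have "3 dvd a" by (rule prime_elem_dvd_power[OF p3])
  then obtain c where c: "a = 3 * c" by blast
  then have "19 * b\<^sup>2 = 3 * c\<^sup>2" using eq by (simp add: power2_eq_square)
  then have "3 dvd 19 * b\<^sup>2" by (rule dvdI)
  then have "3 dvd b\<^sup>2" using prime_elem_dvd_mult_iff[OF p3, of 19 "b\<^sup>2"] by simp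
  then have "3 dvd b" using p3 prime_elem_dvd_power by blast
  then show False using \<open>3 dvd a\<close> b(2) coprime_common_divisor[of a b 3] by simp
qed

text \<open>The norm turns the equation into \<open>N(x)\<^sup>2 = 57 N(y)\<^sup>2\<close> over the rationals.\<close>

lemma nonsquare_norm_57:
  assumes x: "x \<in> carrier ring_A" "y \<in> carrier ring_A"
    and ab: "a \<in> carrier Zloc" "b \<in> carrier Zloc" "eis_norm a b = 57"
    and eq: "x \<otimes>\<^bsub>ring_A\<^esub> x = eis a b \<otimes>\<^bsub>ring_A\<^esub> (y \<otimes>\<^bsub>ring_A\<^esub> y)"
  shows "y = \<zero>\<^bsub>ring_A\<^esub>"
proof -
  obtain c d e f where cd: "c \<in> carrier Zloc" "d \<in> carrier Zloc" "x = eis c d"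
    and ef: "e \<in> carrier Zloc" "f \<in> carrier Zloc" "y = eis e f" using eis_surj x by metis
  have "(eis_norm c d)\<^sup>2 = 57 * (eis_norm e f)\<^sup>2"
    using eq cd ef ab by (simp add: eis_mult eis_eq_iff power2_eq_square flip: eis_norm_mult ab(3)) 
  then show ?thesis using rat_square_ne_57 eis_norm_eq_0 ef eis_zero by metis
qed

text \<open>Here norms give no contradiction, as 57 has norm \<open>57\<^sup>2\<close>. Multiplying \<open>x\<close> by the conjugate of \<open>y\<close> gives
  \<open>r + s\<omega>\<close> whose square is the rational number \<open>57 N(y)\<^sup>2\<close>. The coefficient of \<open>\<omega>\<close> in that square is
  \<open>s(2r - s)\<close>; if \<open>s = 0\<close> then \<open>57 N(y)\<^sup>2\<close> is the rational square \<open>r\<^sup>2\<close>, and if \<open>s = 2r\<close>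
  then it is \<open>-3r\<^sup>2\<close>, which is not positive.\<close>

lemma nonsquare_57:
  assumes x: "x \<in> carrier ring_A" "y \<in> carrier ring_A"
    and eq: "x \<otimes>\<^bsub>ring_A\<^esub> x = eis 57 0 \<otimes>\<^bsub>ring_A\<^esub> (y \<otimes>\<^bsub>ring_A\<^esub> y)"
  shows "y = \<zero>\<^bsub>ring_A\<^esub>"
proof -
  obtain a b c d where ab: "a \<in> carrier Zloc" "b \<in> carrier Zloc" "x = eis a b"
    and cd: "c \<in> carrier Zloc" "d \<in> carrier Zloc" "y = eis c d" using eis_surj x by metis
  define r s where "r = a * (c - d) + b * d" and "s = b * c - a * d"
  have eqs: "a * a - b * b = 57 * (c * c - d * d)" "a * b + b * a - b * b = 57 * (c * d + d * c - d * d)"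
    using eq ab cd by (simp_all add: eis_mult eis_eq_iff)
  have 1: "r\<^sup>2 - s\<^sup>2 = 57 * (eis_norm c d)\<^sup>2" using eqs unfolding r_def s_def eis_norm_def by Groebner_Basis.algebra
  have "s * (2 * r - s) = 0" using eqs unfolding r_def s_def by Groebner_Basis.algebra
  then consider "s = 0" | "s = 2 * r" by auto
  then have "eis_norm c d = 0"
  proof cases
    case 1
    then show ?thesis using \<open>r\<^sup>2 - s\<^sup>2 = _\<close> rat_square_ne_57[of r] by simp
  next
    case 2
    then have "- 3 * r\<^sup>2 = 57 * (eis_norm c d)\<^sup>2" using \<open>r\<^sup>2 - s\<^sup>2 = _\<close> by (simp add: power2_eq_square)
    moreover have "r\<^sup>2 \<ge> 0" "(eis_norm c d)\<^sup>2 \<ge> 0" by simp_all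
    ultimately have "(eis_norm c d)\<^sup>2 = 0" by linarith
    then show ?thesis by simp
  qed
  then show ?thesis using eis_norm_eq_0 cd eis_zero by metis
qed

section \<open>Square roots in quadratic extensions\<close>

text \<open>The elements \<open>a + b\<alpha>\<close> form a field: the inverse is the conjugate \<open>a - b\<alpha>\<close> divided by the norm
  \<open>a\<^sup>2 - b\<^sup>2\<alpha>\<^sup>2\<close>.\<close>

lemma (in field) quadratic_extension_elements:
  assumes L: "subfield L R" and \<alpha>: "\<alpha> \<in> carrier R" "\<alpha> \<otimes> \<alpha> \<in> L"
    and x: "x \<in> generate_field R (L \<union> {\<alpha>})"
  shows "\<exists>a\<in>L. \<exists>b\<in>L. x = a \<oplus> b \<otimes> \<alpha>"
  using x
proof (induction rule: generate_field.induct)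
  note LE = subringE[OF subfieldE(1)[OF L]]
  have Lc: "a \<in> carrier R" if "a \<in> L" for a using that LE(1) by blast
  {
    case one
    show ?case by (intro bexI[of _ \<one>] bexI[of _ \<zero>]) (use LE \<alpha> in simp_all)
  next
    case (incl h)
    show ?case
    proof (cases "h = \<alpha>")
      case True
      then show ?thesis by (intro bexI[of _ \<zero>] bexI[of _ \<one>]) (use LE \<alpha> in simp_all)
    next
      case False
      then show ?thesis using incl Lc by (intro bexI[of _ h] bexI[of _ \<zero>]) (use LE \<alpha> in auto)
    qed
  next
    case (a_inv h)
    then obtain a b where ab: "a \<in> L" "b \<in> L" "h = a \<oplus> b \<otimes> \<alpha>" by blast
    have "\<ominus> h = \<ominus> a \<oplus> (\<ominus> b) \<otimes> \<alpha>"
      using ab Lc \<alpha> by (simp add: minus_add l_minus)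
    then show ?case using ab LE(5) by blast
  next
    case (eng_add h k)
    then obtain a b c d where ab: "a \<in> L" "b \<in> L" "h = a \<oplus> b \<otimes> \<alpha>"
      and cd: "c \<in> L" "d \<in> L" "k = c \<oplus> d \<otimes> \<alpha>" by blast
    have "h \<oplus> k = (a \<oplus> c) \<oplus> (b \<oplus> d) \<otimes> \<alpha>"
      using ab cd Lc \<alpha> by (simp add: l_distr a_ac)
    then show ?case using ab cd LE(7) by blast
  next
    case (eng_mult h k)
    then obtain a b c d where ab: "a \<in> L" "b \<in> L" "h = a \<oplus> b \<otimes> \<alpha>"
      and cd: "c \<in> L" "d \<in> L" "k = c \<oplus> d \<otimes> \<alpha>" by blast
    have carr: "a \<in> carrier R" "b \<in> carrier R" "c \<in> carrier R" "d \<in> carrier R"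
      using ab cd Lc by auto
    have "h \<otimes> k = (a \<otimes> c \<oplus> b \<otimes> d \<otimes> (\<alpha> \<otimes> \<alpha>)) \<oplus> (a \<otimes> d \<oplus> b \<otimes> c) \<otimes> \<alpha>"
      unfolding ab cd using carr \<alpha>(1) by algebra
    moreover have "a \<otimes> c \<oplus> b \<otimes> d \<otimes> (\<alpha> \<otimes> \<alpha>) \<in> L" "a \<otimes> d \<oplus> b \<otimes> c \<in> L"
      using ab cd \<alpha> LE(6,7) by simp_all
    ultimately show ?case by blast
  next
    case (m_inv h)
    then obtain a b where ab: "a \<in> L" "b \<in> L" "h = a \<oplus> b \<otimes> \<alpha>" by blast
    have carr: "a \<in> carrier R" "b \<in> carrier R" "h \<in> carrier R" using ab Lc \<alpha> by auto
    have h: "h \<in> Units R" using carr m_inv field_Units by simp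
    define n where "n = a \<otimes> a \<ominus> b \<otimes> b \<otimes> (\<alpha> \<otimes> \<alpha>)"
    have n: "n \<in> L" using ab \<alpha> LE(5-7) by (simp add: n_def minus_eq)
    have norm: "h \<otimes> (a \<ominus> b \<otimes> \<alpha>) = n"
      unfolding ab n_def using carr \<alpha>(1) by algebra
    show ?case
    proof (cases "n = \<zero>")
      case True
      \<comment> \<open>If the norm vanishes then \<open>a = b\<alpha>\<close>, so that the element is \<open>a + a\<close> and lies in \<open>L\<close>.\<close>
      then have "a \<ominus> b \<otimes> \<alpha> = \<zero>"
        using norm m_inv(2) carr \<alpha> integral_iff[of h "a \<ominus> b \<otimes> \<alpha>"] by simp
      then have "a = b \<otimes> \<alpha>" using carr \<alpha> by simp
      then have "h \<in> L" using ab LE(7) by metis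
      then have "inv h \<in> L" using subfield_m_inv(1)[OF L, of h] m_inv(2) by simp
      then show ?thesis by (intro bexI[of _ "inv h"] bexI[of _ \<zero>]) (use LE \<alpha> h in simp_all)
    next
      case False
      then have i: "inv n \<in> L" "n \<otimes> inv n = \<one>" using subfield_m_inv[OF L, of n] n by simp_all
      have "inv h = inv h \<otimes> (h \<otimes> (a \<ominus> b \<otimes> \<alpha>)) \<otimes> inv n"
        unfolding norm using i h n Lc by (simp add: m_assoc)
      also have "\<dots> = (a \<ominus> b \<otimes> \<alpha>) \<otimes> inv n"
        using h carr \<alpha> i Lc by (simp flip: m_assoc)
      also have "\<dots> = a \<otimes> inv n \<oplus> (\<ominus> b \<otimes> inv n) \<otimes> \<alpha>"
        using carr \<alpha>(1) Lc[OF i(1)] by algebra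
      finally show ?thesis using ab i LE(5,6) by blast
    qed
  }
qed

text \<open>Squaring \<open>v = a + b\<alpha>\<close> produces the cross term \<open>2ab\<alpha>\<close>. It lies in \<open>L\<close>, so that either \<open>\<alpha> \<in> L\<close> or
  one of \<open>a\<close>, \<open>b\<close> is zero. In the last cases \<open>v = a\<close>, or \<open>v\<^sup>2\<alpha>\<^sup>2 = (b\<alpha>\<^sup>2)\<^sup>2\<close>.\<close>

lemma (in field) square_in_quadratic_extension:
  assumes L: "subfield L R" and \<alpha>: "\<alpha> \<in> carrier R" "\<alpha> \<otimes> \<alpha> \<in> L" and two: "\<one> \<oplus> \<one> \<noteq> \<zero>"
    and v: "v \<in> generate_field R (L \<union> {\<alpha>})" "v \<otimes> v \<in> L"
  shows "\<exists>x\<in>L. x \<otimes> x = \<alpha> \<otimes> \<alpha> \<or> x \<otimes> x = v \<otimes> v \<or> x \<otimes> x = \<alpha> \<otimes> \<alpha> \<otimes> (v \<otimes> v)"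
proof -
  note LE = subringE[OF subfieldE(1)[OF L]]
  obtain a b where ab: "a \<in> L" "b \<in> L" "v = a \<oplus> b \<otimes> \<alpha>"
    using quadratic_extension_elements[OF L \<alpha> v(1)] by blast
  have carr: "a \<in> carrier R" "b \<in> carrier R" using ab LE(1) by auto
  consider "b = \<zero>" | "a = \<zero>" | "a \<otimes> b \<noteq> \<zero>" using carr integral by blast
  then show ?thesis
  proof cases
    case 1
    then have "v = a" using ab carr \<alpha> by simp
    then show ?thesis using ab by blast
  next
    case 2
    then have "v = b \<otimes> \<alpha>" using ab carr \<alpha> by simp
    then have "(b \<otimes> (\<alpha> \<otimes> \<alpha>)) \<otimes> (b \<otimes> (\<alpha> \<otimes> \<alpha>)) = \<alpha> \<otimes> \<alpha> \<otimes> (v \<otimes> v)"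
      using carr \<alpha> by (simp add: m_ac)
    then show ?thesis using ab \<alpha> LE(6) by blast
  next
    case 3
    define t where "t = (\<one> \<oplus> \<one>) \<otimes> (a \<otimes> b)"
    have t: "t \<in> L" "t \<noteq> \<zero>" "t \<in> carrier R"
      using 3 two ab carr LE(3,6,7) by (simp_all add: t_def integral_iff)
    have "v \<otimes> v \<ominus> a \<otimes> a \<ominus> b \<otimes> b \<otimes> (\<alpha> \<otimes> \<alpha>) = t \<otimes> \<alpha>"
      unfolding ab t_def using carr \<alpha>(1) one_closed by algebra
    then have "t \<otimes> \<alpha> \<in> L" using ab v \<alpha> LE(5-7) by (metis minus_eq)
    moreover have i: "inv t \<in> L" "inv t \<otimes> t = \<one>" using subfield_m_inv[OF L, of t] t by simp_all
    moreover have "inv t \<otimes> (t \<otimes> \<alpha>) = \<alpha>"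
      using i t \<alpha> LE(1) by (metis l_one m_assoc subsetD)
    ultimately have "\<alpha> \<in> L" using LE(6) by metis
    then show ?thesis by blast
  qed
qed

section \<open>The ring of elements of L(w) in V\<close>

interpretation V: p_uniformized_ring ring_V 2
  unfolding ring_V_def by (rule p_uniformized_ring.completion_p_uniformized[OF A_p_uniformized])

lemma field_K_field: "field field_K"
  unfolding field_K_def by (rule V.frac_field)

definition A_to_K :: "rat list set \<Rightarrow> ((nat \<Rightarrow> rat list set set) \<times> (nat \<Rightarrow> rat list set set)) set" where
  "A_to_K x = to_fraction_field ring_V (to_p_completion ring_A 2 x)"

lemma A_to_V_hom: "to_p_completion ring_A 2 \<in> ring_hom ring_A ring_V"
  and A_to_V_inj: "inj_on (to_p_completion ring_A 2) (carrier ring_A)"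
proof -
  interpret A: p_uniformized_ring ring_A 2 by (rule A_p_uniformized)
  show h: "to_p_completion ring_A 2 \<in> ring_hom ring_A ring_V"
    unfolding ring_V_def by (rule A.to_completion_hom)
  interpret h: ring_hom_ring ring_A ring_V "to_p_completion ring_A 2"
    by (rule ring_hom_ringI2[OF A.ring_axioms V.ring_axioms h])
  show "inj_on (to_p_completion ring_A 2) (carrier ring_A)"
  proof (rule inj_onI)
    fix x y assume xy: "x \<in> carrier ring_A" "y \<in> carrier ring_A"
      "to_p_completion ring_A 2 x = to_p_completion ring_A 2 y"
    then have "to_p_completion ring_A 2 (x \<ominus>\<^bsub>ring_A\<^esub> y) = \<zero>\<^bsub>ring_V\<^esub>"
      by (simp add: A.minus_eq V.r_neg)
    then have "x \<ominus>\<^bsub>ring_A\<^esub> y = \<zero>\<^bsub>ring_A\<^esub>"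
      using A.to_completion_inj[of "x \<ominus>\<^bsub>ring_A\<^esub> y"] xy by (simp add: ring_V_def)
    then show "x = y" using xy by simp
  qed
qed

lemma V_to_K_hom: "to_fraction_field ring_V \<in> ring_hom ring_V field_K"
  and V_to_K_inj: "inj_on (to_fraction_field ring_V) (carrier ring_V)"
  unfolding field_K_def by (rule V.to_frac_hom V.to_frac_inj)+

lemma A_to_K_hom: "A_to_K \<in> ring_hom ring_A field_K"
proof -
  have "A_to_K = to_fraction_field ring_V \<circ> to_p_completion ring_A 2"
    by (simp add: A_to_K_def fun_eq_iff)
  then show ?thesis using ring_hom_trans[OF A_to_V_hom V_to_K_hom] by simp
qed

lemma A_to_K_ring_hom: "ring_hom_ring ring_A field_K A_to_K"
proof -
  interpret K: field field_K by (rule field_K_field)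
  show ?thesis by (rule ring_hom_ringI2[OF A.ring_axioms K.ring_axioms A_to_K_hom])
qed

lemma A_to_K_eq_iff:
  assumes "x \<in> carrier ring_A" "y \<in> carrier ring_A" shows "A_to_K x = A_to_K y \<longleftrightarrow> x = y"
  using assms A_to_V_inj V_to_K_inj ring_hom_closed[OF A_to_V_hom]
  unfolding A_to_K_def by (metis inj_onD)

lemma L_in_K_eq:
  "L_in_K = {a \<otimes>\<^bsub>field_K\<^esub> inv\<^bsub>field_K\<^esub> b | a b. a \<in> A_to_K ` carrier ring_A \<and>
     b \<in> A_to_K ` carrier ring_A \<and> b \<noteq> \<zero>\<^bsub>field_K\<^esub>}" (is "_ = ?L")
proof -
  interpret A: p_uniformized_ring ring_A 2 by (rule A_p_uniformized)
  interpret K: field field_K by (rule field_K_field)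
  interpret g: ring_hom_ring ring_A field_K A_to_K by (rule A_to_K_ring_hom)
  have map: "fraction_field_map ring_V (to_p_completion ring_A 2) (frac_class ring_A a b)
      = A_to_K a \<otimes>\<^bsub>field_K\<^esub> inv\<^bsub>field_K\<^esub> A_to_K b"
    if ab: "a \<in> carrier ring_A" "b \<in> carrier ring_A" "b \<noteq> \<zero>\<^bsub>ring_A\<^esub>" for a b
  proof -
    let ?j = "to_p_completion ring_A 2"
    have "?j b \<noteq> \<zero>\<^bsub>ring_V\<^esub>"
      using A_to_V_inj ab ring_hom_zero[OF A_to_V_hom A.ring_axioms V.ring_axioms]
      by (metis A.zero_closed inj_onD)
    then have "frac_class ring_V (?j a) (?j b) = A_to_K a \<otimes>\<^bsub>field_K\<^esub> inv\<^bsub>field_K\<^esub> A_to_K b"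
      unfolding A_to_K_def field_K_def
      by (intro V.frac_class_eq_quotient ring_hom_closed[OF A_to_V_hom] ab)
    then show ?thesis
      using A.fraction_field_map_frac_class[OF V.domain_axioms A_to_V_hom A_to_V_inj ab] by simp
  qed
  have nz: "A_to_K b \<noteq> \<zero>\<^bsub>field_K\<^esub> \<longleftrightarrow> b \<noteq> \<zero>\<^bsub>ring_A\<^esub>" if "b \<in> carrier ring_A" for b
    using A_to_K_eq_iff[OF that A.zero_closed] by simp
  show ?thesis
  proof
    show "L_in_K \<subseteq> ?L"
    proof
      fix x assume "x \<in> L_in_K"
      then obtain C where C: "C \<in> carrier (fraction_field ring_A)"
        "x = fraction_field_map ring_V (to_p_completion ring_A 2) C"
        unfolding L_in_K_def by blast
      from C(1) obtain a b where ab: "a \<in> carrier ring_A" "b \<in> carrier ring_A" "b \<noteq> \<zero>\<^bsub>ring_A\<^esub>"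
        "x = fraction_field_map ring_V (to_p_completion ring_A 2) (frac_class ring_A a b)"
        by (rule A.frac_cases) (use C(2) in blast)
      then have "x = A_to_K a \<otimes>\<^bsub>field_K\<^esub> inv\<^bsub>field_K\<^esub> A_to_K b" using map by simp
      moreover have "A_to_K b \<noteq> \<zero>\<^bsub>field_K\<^esub>" using nz ab by simp
      ultimately show "x \<in> ?L" using ab(1,2) by blast
    qed
    show "?L \<subseteq> L_in_K"
    proof
      fix x assume "x \<in> ?L"
      then obtain a b where ab: "a \<in> carrier ring_A" "b \<in> carrier ring_A" "A_to_K b \<noteq> \<zero>\<^bsub>field_K\<^esub>"
        "x = A_to_K a \<otimes>\<^bsub>field_K\<^esub> inv\<^bsub>field_K\<^esub> A_to_K b" by blast
      then have b: "b \<noteq> \<zero>\<^bsub>ring_A\<^esub>" using nz by blast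
      then have "x = fraction_field_map ring_V (to_p_completion ring_A 2) (frac_class ring_A a b)"
        using map ab by simp
      then show "x \<in> L_in_K" unfolding L_in_K_def using A.frac_closed[OF ab(1,2) b] by blast
    qed
  qed
qed

lemma L_in_K_subfield: "subfield L_in_K field_K"
proof -
  interpret K: field field_K by (rule field_K_field)
  interpret g: ring_hom_ring ring_A field_K A_to_K by (rule A_to_K_ring_hom)
  show ?thesis unfolding L_in_K_eq
    by (rule K.subring_fractions_subfield[OF g.img_is_subring[OF A.carrier_is_subring]])
qed

lemma A_to_K_in_L: assumes "a \<in> carrier ring_A" shows "A_to_K a \<in> L_in_K"
proof -
  interpret K: field field_K by (rule field_K_field)
  interpret g: ring_hom_ring ring_A field_K A_to_K by (rule A_to_K_ring_hom)
  have "A_to_K a = A_to_K a \<otimes>\<^bsub>field_K\<^esub> inv\<^bsub>field_K\<^esub> A_to_K \<one>\<^bsub>ring_A\<^esub>" using assms by simp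
  then show ?thesis unfolding L_in_K_eq using assms A.one_closed g.hom_one K.one_not_zero by blast
qed

lemma square_in_L:
  assumes x: "x \<in> L_in_K" and c: "c \<in> carrier ring_A" and sq: "x \<otimes>\<^bsub>field_K\<^esub> x = A_to_K c"
  shows "\<exists>a\<in>carrier ring_A. \<exists>b\<in>carrier ring_A. b \<noteq> \<zero>\<^bsub>ring_A\<^esub> \<and>
    a \<otimes>\<^bsub>ring_A\<^esub> a = c \<otimes>\<^bsub>ring_A\<^esub> (b \<otimes>\<^bsub>ring_A\<^esub> b)"
proof -
  interpret K: field field_K by (rule field_K_field)
  interpret g: ring_hom_ring ring_A field_K A_to_K by (rule A_to_K_ring_hom)
  obtain a b where ab: "a \<in> carrier ring_A" "b \<in> carrier ring_A" "A_to_K b \<noteq> \<zero>\<^bsub>field_K\<^esub>"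
    "x = A_to_K a \<otimes>\<^bsub>field_K\<^esub> inv\<^bsub>field_K\<^esub> A_to_K b" using x unfolding L_in_K_eq by auto
  have b: "A_to_K b \<in> Units field_K" using ab K.field_Units by simp
  have xc: "x \<in> carrier field_K" using ab b by simp
  have xb: "x \<otimes>\<^bsub>field_K\<^esub> A_to_K b = A_to_K a" using ab b by (simp add: K.m_assoc)
  have "A_to_K (a \<otimes>\<^bsub>ring_A\<^esub> a) = (x \<otimes>\<^bsub>field_K\<^esub> A_to_K b) \<otimes>\<^bsub>field_K\<^esub> (x \<otimes>\<^bsub>field_K\<^esub> A_to_K b)"
    using ab xb by simp
  also have "\<dots> = (x \<otimes>\<^bsub>field_K\<^esub> x) \<otimes>\<^bsub>field_K\<^esub> (A_to_K b \<otimes>\<^bsub>field_K\<^esub> A_to_K b)"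
    using xc ab by (simp add: K.m_ac)
  also have "\<dots> = A_to_K (c \<otimes>\<^bsub>ring_A\<^esub> (b \<otimes>\<^bsub>ring_A\<^esub> b))" using ab c sq by simp
  finally have "a \<otimes>\<^bsub>ring_A\<^esub> a = c \<otimes>\<^bsub>ring_A\<^esub> (b \<otimes>\<^bsub>ring_A\<^esub> b)"
    using A_to_K_eq_iff[of "a \<otimes>\<^bsub>ring_A\<^esub> a" "c \<otimes>\<^bsub>ring_A\<^esub> (b \<otimes>\<^bsub>ring_A\<^esub> b)"] ab c by blast
  moreover have "b \<noteq> \<zero>\<^bsub>ring_A\<^esub>" using ab by auto
  ultimately show ?thesis using ab by blast
qed

text \<open>In coordinates, \<open>1 + 8\<omega>\<^sup>2 = -7 - 8\<omega>\<close>.\<close>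

lemma conj_sqrt_not_in_extension:
  assumes w: "w \<in> carrier field_K" "w \<otimes>\<^bsub>field_K\<^esub> w = A_to_K (eis 1 8)"
    and v: "v \<in> generate_field field_K (L_in_K \<union> {w})"
  shows "v \<otimes>\<^bsub>field_K\<^esub> v \<noteq> A_to_K (eis (- 7) (- 8))"
proof
  interpret K: field field_K by (rule field_K_field)
  interpret g: ring_hom_ring ring_A field_K A_to_K by (rule A_to_K_ring_hom)
  assume sq: "v \<otimes>\<^bsub>field_K\<^esub> v = A_to_K (eis (- 7) (- 8))"
  have "A_to_K (eis 1 0 \<oplus>\<^bsub>ring_A\<^esub> eis 1 0) \<noteq> A_to_K (eis 0 0)"
    by (simp add: A_to_K_eq_iff eis_add eis_eq_iff)
  then have two: "\<one>\<^bsub>field_K\<^esub> \<oplus>\<^bsub>field_K\<^esub> \<one>\<^bsub>field_K\<^esub> \<noteq> \<zero>\<^bsub>field_K\<^esub>"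
    by (simp flip: eis_one eis_zero)
  have prod: "A_to_K (eis 1 8) \<otimes>\<^bsub>field_K\<^esub> A_to_K (eis (- 7) (- 8)) = A_to_K (eis 57 0)"
    by (simp add: eis_mult flip: g.hom_mult)
  have "\<exists>x\<in>L_in_K. x \<otimes>\<^bsub>field_K\<^esub> x = A_to_K (eis 1 8) \<or> x \<otimes>\<^bsub>field_K\<^esub> x = A_to_K (eis (- 7) (- 8))
     \<or> x \<otimes>\<^bsub>field_K\<^esub> x = A_to_K (eis 57 0)"
    using K.square_in_quadratic_extension[OF L_in_K_subfield w(1) _ two v]
    unfolding w(2) sq prod by (simp add: A_to_K_in_L)
  then obtain x c where x: "x \<in> L_in_K" "x \<otimes>\<^bsub>field_K\<^esub> x = A_to_K c"
    and c: "c \<in> {eis 1 8, eis (- 7) (- 8), eis 57 0}" by blast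
  have "c \<in> carrier ring_A" using c by auto
  from square_in_L[OF x(1) this x(2)] obtain a b where
    ab: "a \<in> carrier ring_A" "b \<in> carrier ring_A" "b \<noteq> \<zero>\<^bsub>ring_A\<^esub>"
      "a \<otimes>\<^bsub>ring_A\<^esub> a = c \<otimes>\<^bsub>ring_A\<^esub> (b \<otimes>\<^bsub>ring_A\<^esub> b)" by blast
  show False
    using c ab nonsquare_norm_57[of a b 1 8] nonsquare_norm_57[of a b "- 7" "- 8"] nonsquare_57[of a b]
    by (auto simp: eis_norm_def)
qed

text \<open>With \<open>u\<^sup>2 + u = 2\<omega>\<close>, the square of \<open>1 + 2u\<close> is \<open>1 + 4(u\<^sup>2 + u) = 1 + 8\<omega>\<close>.\<close>

lemma sqrt_in_V:
  "\<exists>w\<in>carrier ring_V. w \<otimes>\<^bsub>ring_V\<^esub> w = to_p_completion ring_A 2 (eis 1 8)"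
proof -
  interpret A: p_uniformized_ring ring_A 2 by (rule A_p_uniformized)
  let ?j = "to_p_completion ring_A 2"
  have "nat_image ring_A 2 \<otimes>\<^bsub>ring_A\<^esub> \<omega> = eis 0 2"
    by (simp add: nat_image_A omega_eis eis_mult)
  then obtain u where u: "u \<in> carrier ring_V" "u \<otimes>\<^bsub>ring_V\<^esub> u \<oplus>\<^bsub>ring_V\<^esub> u = ?j (eis 0 2)"
    using A.completion_quadratic_root[OF omega_closed] unfolding ring_V_def by auto
  define w where "w = \<one>\<^bsub>ring_V\<^esub> \<oplus>\<^bsub>ring_V\<^esub> u \<oplus>\<^bsub>ring_V\<^esub> u"
  let ?z = "u \<otimes>\<^bsub>ring_V\<^esub> u \<oplus>\<^bsub>ring_V\<^esub> u"
  have "w \<otimes>\<^bsub>ring_V\<^esub> w = \<one>\<^bsub>ring_V\<^esub> \<oplus>\<^bsub>ring_V\<^esub> (?z \<oplus>\<^bsub>ring_V\<^esub> ?z \<oplus>\<^bsub>ring_V\<^esub> ?z \<oplus>\<^bsub>ring_V\<^esub> ?z)"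
    unfolding w_def using u(1) V.one_closed by algebra
  also have "\<dots> = ?j (eis 1 0 \<oplus>\<^bsub>ring_A\<^esub> (eis 0 2 \<oplus>\<^bsub>ring_A\<^esub> eis 0 2 \<oplus>\<^bsub>ring_A\<^esub> eis 0 2 \<oplus>\<^bsub>ring_A\<^esub> eis 0 2))"
    unfolding u(2) using A_to_V_hom
    by (simp add: ring_hom_add[OF A_to_V_hom] ring_hom_one flip: eis_one)
  also have "\<dots> = ?j (eis 1 8)" by (simp add: eis_add)
  finally show ?thesis using u by (intro bexI[of _ w]) (simp_all add: w_def)
qed

text \<open>The lift \<open>\<phi>\<close> of Frobenius must conjugate \<open>\<omega>\<close>, hence it would send \<open>w\<close> to a square root of
  \<open>1 + 8\<omega>\<^sup>2\<close>.\<close>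

lemma no_2_derivation:
  assumes w: "w \<in> V_in_K" "w \<otimes>\<^bsub>field_K\<^esub> w = A_to_K (eis 1 8)"
    and R: "p_uniformized_ring (ring_R w) 2"
  shows "\<not> p_derivation 2 (ring_R w) \<delta>"
proof
  interpret K: field field_K by (rule field_K_field)
  interpret g: ring_hom_ring ring_A field_K A_to_K by (rule A_to_K_ring_hom)
  assume \<delta>: "p_derivation 2 (ring_R w) \<delta>"
  interpret R: p_uniformized_ring "ring_R w" 2 by (rule R)
  define \<phi> where "\<phi> s = s \<otimes>\<^bsub>field_K\<^esub> s \<oplus>\<^bsub>field_K\<^esub> (\<delta> s \<oplus>\<^bsub>field_K\<^esub> \<delta> s)" for s
  have ops: "(\<otimes>\<^bsub>ring_R w\<^esub>) = (\<otimes>\<^bsub>field_K\<^esub>)" "(\<oplus>\<^bsub>ring_R w\<^esub>) = (\<oplus>\<^bsub>field_K\<^esub>)"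
    "\<one>\<^bsub>ring_R w\<^esub> = \<one>\<^bsub>field_K\<^esub>" "\<zero>\<^bsub>ring_R w\<^esub> = \<zero>\<^bsub>field_K\<^esub>"
    by (simp_all add: ring_R_def)
  have carr: "carrier (ring_R w) = generate_field field_K (L_in_K \<union> {w}) \<inter> V_in_K"
    by (simp add: ring_R_def)
  have V_sub: "V_in_K \<subseteq> carrier field_K"
    unfolding V_in_K_def using ring_hom_closed[OF V_to_K_hom] by blast
  have RK: "x \<in> carrier field_K" if "x \<in> carrier (ring_R w)" for x
    using that V_sub carr by auto
  have A_R: "A_to_K a \<in> carrier (ring_R w)" if "a \<in> carrier ring_A" for a
    using that ring_hom_closed[OF A_to_V_hom that] A_to_K_in_L
    unfolding carr V_in_K_def A_to_K_def by (auto intro: generate_field.incl)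
  have w_R: "w \<in> carrier (ring_R w)"
    using w unfolding carr by (auto intro: generate_field.incl)
  have \<delta>_R: "\<delta> s \<in> carrier (ring_R w)" if "s \<in> carrier (ring_R w)" for s
    using \<delta> that unfolding p_derivation_def by blast
  have sq: "s [^]\<^bsub>ring_R w\<^esub> (2::nat) \<oplus>\<^bsub>ring_R w\<^esub> [(2::nat)] \<cdot>\<^bsub>ring_R w\<^esub> \<delta> s = \<phi> s"
    if "s \<in> carrier (ring_R w)" for s
    using that \<delta>_R RK by (simp add: numeral_2_eq_2 \<phi>_def ops add_pow_def nat_pow_def)
  have \<phi>: "\<phi> \<in> ring_hom (ring_R w) (ring_R w)"
  proof -
    have "(\<lambda>s. s [^]\<^bsub>ring_R w\<^esub> (2::nat) \<oplus>\<^bsub>ring_R w\<^esub> [(2::nat)] \<cdot>\<^bsub>ring_R w\<^esub> \<delta> s) \<in> ring_hom (ring_R w) (ring_R w)"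
      using \<delta> unfolding p_derivation_def by blast
    then show ?thesis by (rule R.ring_hom_restrict) (simp add: sq)
  qed
  have \<phi>_add: "\<phi> (x \<oplus>\<^bsub>field_K\<^esub> y) = \<phi> x \<oplus>\<^bsub>field_K\<^esub> \<phi> y"
    and \<phi>_mult: "\<phi> (x \<otimes>\<^bsub>field_K\<^esub> y) = \<phi> x \<otimes>\<^bsub>field_K\<^esub> \<phi> y"
    if "x \<in> carrier (ring_R w)" "y \<in> carrier (ring_R w)" for x y
    using ring_hom_add[OF \<phi> that] ring_hom_mult[OF \<phi> that] by (simp_all add: ops)
  have \<phi>_one: "\<phi> \<one>\<^bsub>field_K\<^esub> = \<one>\<^bsub>field_K\<^esub>" using ring_hom_one[OF \<phi>] by (simp add: ops)
  have \<phi>_R: "\<phi> x \<in> carrier (ring_R w)" if "x \<in> carrier (ring_R w)" for x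
    using ring_hom_closed[OF \<phi> that] .
  define \<zeta> where "\<zeta> = A_to_K \<omega>"
  have \<zeta>: "\<zeta> \<in> carrier (ring_R w)" "\<zeta> \<in> carrier field_K" using A_R by (simp_all add: \<zeta>_def)
  have \<zeta>_root: "\<zeta> \<otimes>\<^bsub>field_K\<^esub> \<zeta> \<oplus>\<^bsub>field_K\<^esub> \<zeta> \<oplus>\<^bsub>field_K\<^esub> \<one>\<^bsub>field_K\<^esub> = \<zero>\<^bsub>field_K\<^esub>"
    using arg_cong[OF omega_root, of A_to_K] by (simp add: \<zeta>_def)
  let ?\<eta> = "\<phi> \<zeta>"
  have \<eta>: "?\<eta> \<in> carrier (ring_R w)" "?\<eta> \<in> carrier field_K" using \<phi>_R[OF \<zeta>(1)] RK by auto
  have closed: "x \<oplus>\<^bsub>field_K\<^esub> y \<in> carrier (ring_R w)" "x \<otimes>\<^bsub>field_K\<^esub> y \<in> carrier (ring_R w)"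
    if "x \<in> carrier (ring_R w)" "y \<in> carrier (ring_R w)" for x y
    using R.a_closed[OF that] R.m_closed[OF that] by (simp_all add: ops)
  have one_R: "\<one>\<^bsub>field_K\<^esub> \<in> carrier (ring_R w)"
    using R.one_closed by (simp_all add: ops)
  have \<eta>_root: "?\<eta> \<otimes>\<^bsub>field_K\<^esub> ?\<eta> \<oplus>\<^bsub>field_K\<^esub> ?\<eta> \<oplus>\<^bsub>field_K\<^esub> \<one>\<^bsub>field_K\<^esub> = \<zero>\<^bsub>field_K\<^esub>"
  proof -
    have "\<phi> \<zero>\<^bsub>field_K\<^esub> = \<zero>\<^bsub>field_K\<^esub>"
      using ring_hom_zero[OF \<phi> R.ring_axioms R.ring_axioms] by (simp add: ops)
    then show ?thesis
      using arg_cong[OF \<zeta>_root, of \<phi>] \<zeta>(1) one_R by (simp add: \<phi>_add \<phi>_mult \<phi>_one closed)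
  qed
  have "(?\<eta> \<ominus>\<^bsub>field_K\<^esub> \<zeta>) \<otimes>\<^bsub>field_K\<^esub> (?\<eta> \<oplus>\<^bsub>field_K\<^esub> \<zeta> \<oplus>\<^bsub>field_K\<^esub> \<one>\<^bsub>field_K\<^esub>)
    = (?\<eta> \<otimes>\<^bsub>field_K\<^esub> ?\<eta> \<oplus>\<^bsub>field_K\<^esub> ?\<eta> \<oplus>\<^bsub>field_K\<^esub> \<one>\<^bsub>field_K\<^esub>)
      \<ominus>\<^bsub>field_K\<^esub> (\<zeta> \<otimes>\<^bsub>field_K\<^esub> \<zeta> \<oplus>\<^bsub>field_K\<^esub> \<zeta> \<oplus>\<^bsub>field_K\<^esub> \<one>\<^bsub>field_K\<^esub>)"
    using \<eta>(2) \<zeta>(2) K.one_closed by algebra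
  \<comment> \<open>Two roots of \<open>x\<^sup>2 + x + 1\<close> are equal or have sum \<open>-1\<close>.\<close>
  then have "(?\<eta> \<ominus>\<^bsub>field_K\<^esub> \<zeta>) \<otimes>\<^bsub>field_K\<^esub> (?\<eta> \<oplus>\<^bsub>field_K\<^esub> \<zeta> \<oplus>\<^bsub>field_K\<^esub> \<one>\<^bsub>field_K\<^esub>) = \<zero>\<^bsub>field_K\<^esub>"
    unfolding \<zeta>_root \<eta>_root by (simp add: K.minus_eq)
  then consider "?\<eta> = \<zeta>" | "?\<eta> \<oplus>\<^bsub>field_K\<^esub> \<zeta> \<oplus>\<^bsub>field_K\<^esub> \<one>\<^bsub>field_K\<^esub> = \<zero>\<^bsub>field_K\<^esub>"
    using \<eta>(2) \<zeta>(2) K.integral_iff by auto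
  then show False
  proof cases
    case 1
    \<comment> \<open>From \<open>\<zeta> = \<zeta>\<^sup>2 + 2d\<close> and \<open>\<zeta>\<^sup>2 = -\<zeta> - 1\<close>, the element \<open>d - \<zeta>\<close> would be an inverse of 2.\<close>
    define d where "d = \<delta> \<zeta>"
    have d: "d \<in> carrier (ring_R w)" "d \<in> carrier field_K" using \<delta>_R[OF \<zeta>(1)] RK by (auto simp: d_def)
    have eq: "\<zeta> \<otimes>\<^bsub>field_K\<^esub> \<zeta> \<oplus>\<^bsub>field_K\<^esub> (d \<oplus>\<^bsub>field_K\<^esub> d) = \<zeta>" using 1 by (simp add: \<phi>_def d_def)
    have "(d \<ominus>\<^bsub>field_K\<^esub> \<zeta>) \<oplus>\<^bsub>field_K\<^esub> (d \<ominus>\<^bsub>field_K\<^esub> \<zeta>) =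
      ((\<zeta> \<otimes>\<^bsub>field_K\<^esub> \<zeta> \<oplus>\<^bsub>field_K\<^esub> (d \<oplus>\<^bsub>field_K\<^esub> d)) \<ominus>\<^bsub>field_K\<^esub> \<zeta>)
        \<ominus>\<^bsub>field_K\<^esub> (\<zeta> \<otimes>\<^bsub>field_K\<^esub> \<zeta> \<oplus>\<^bsub>field_K\<^esub> \<zeta> \<oplus>\<^bsub>field_K\<^esub> \<one>\<^bsub>field_K\<^esub>) \<oplus>\<^bsub>field_K\<^esub> \<one>\<^bsub>field_K\<^esub>"
      using d(2) \<zeta>(2) K.one_closed by algebra
    also have "\<dots> = \<one>\<^bsub>field_K\<^esub>" unfolding eq \<zeta>_root using \<zeta>(2) by (simp add: K.minus_eq K.r_neg)
    finally have one: "(d \<ominus>\<^bsub>field_K\<^esub> \<zeta>) \<oplus>\<^bsub>field_K\<^esub> (d \<ominus>\<^bsub>field_K\<^esub> \<zeta>) = \<one>\<^bsub>field_K\<^esub>" .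
    have "d \<ominus>\<^bsub>field_K\<^esub> \<zeta> \<in> carrier (ring_R w)"
    proof -
      have "A_to_K (eis (- 1) 0) \<oplus>\<^bsub>field_K\<^esub> \<one>\<^bsub>field_K\<^esub> = \<zero>\<^bsub>field_K\<^esub>"
        by (simp add: eis_add eis_one eis_zero flip: g.hom_add g.hom_one g.hom_zero)
      then have "\<ominus>\<^bsub>field_K\<^esub> \<one>\<^bsub>field_K\<^esub> = A_to_K (eis (- 1) 0)"
        by (simp add: K.minus_equality)
      then have "d \<ominus>\<^bsub>field_K\<^esub> \<zeta> = d \<oplus>\<^bsub>field_K\<^esub> A_to_K (eis (- 1) 0) \<otimes>\<^bsub>field_K\<^esub> \<zeta>"
        using \<zeta>(2) by (metis K.l_minus K.l_one K.minus_eq K.one_closed)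
      then show ?thesis using closed d \<zeta> A_R by simp
    qed
    moreover have "nat_image (ring_R w) 2 \<otimes>\<^bsub>field_K\<^esub> (d \<ominus>\<^bsub>field_K\<^esub> \<zeta>) = \<one>\<^bsub>field_K\<^esub>"
    proof -
      have "nat_image (ring_R w) 2 = \<one>\<^bsub>field_K\<^esub> \<oplus>\<^bsub>field_K\<^esub> \<one>\<^bsub>field_K\<^esub>"
        using R.nat_image_Suc[of 1] by (simp add: numeral_2_eq_2 ops)
      then show ?thesis using one d(2) \<zeta>(2) by (simp add: K.l_distr)
    qed
    ultimately have "nat_image (ring_R w) 2 \<in> Units (ring_R w)"
      using R.m_comm[of "nat_image (ring_R w) 2" "d \<ominus>\<^bsub>field_K\<^esub> \<zeta>"]
      unfolding Units_def by (auto simp: ops)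
    then show False using R.p_not_unit by simp
  next
    case 2
    have inv: "A_to_K (eis (- 1) (- 1)) \<oplus>\<^bsub>field_K\<^esub> (\<zeta> \<oplus>\<^bsub>field_K\<^esub> \<one>\<^bsub>field_K\<^esub>) = \<zero>\<^bsub>field_K\<^esub>"
      by (simp add: \<zeta>_def eis_add eis_one eis_zero omega_eis flip: g.hom_add g.hom_one g.hom_zero)
    have \<eta>_eq: "?\<eta> = A_to_K (eis (- 1) (- 1))"
    proof -
      have "?\<eta> \<oplus>\<^bsub>field_K\<^esub> (\<zeta> \<oplus>\<^bsub>field_K\<^esub> \<one>\<^bsub>field_K\<^esub>) = \<zero>\<^bsub>field_K\<^esub>"
        using 2 \<eta>(2) \<zeta>(2) by (simp add: K.a_assoc)
      then have "\<ominus>\<^bsub>field_K\<^esub> (\<zeta> \<oplus>\<^bsub>field_K\<^esub> \<one>\<^bsub>field_K\<^esub>) = ?\<eta>"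
        using \<eta>(2) \<zeta>(2) by (intro K.minus_equality) simp_all
      moreover have "\<ominus>\<^bsub>field_K\<^esub> (\<zeta> \<oplus>\<^bsub>field_K\<^esub> \<one>\<^bsub>field_K\<^esub>) = A_to_K (eis (- 1) (- 1))"
        using inv \<zeta>(2) by (intro K.minus_equality) simp_all
      ultimately show ?thesis by simp
    qed
    \<comment> \<open>Doubling three times writes \<open>1 + 8\<zeta>\<close> with ring additions only, so that \<open>\<phi>\<close> can be applied.\<close>
    let ?dbl = "\<lambda>x. x \<oplus>\<^bsub>field_K\<^esub> x"
    have "A_to_K (eis 1 8) = \<one>\<^bsub>field_K\<^esub> \<oplus>\<^bsub>field_K\<^esub> ?dbl (?dbl (?dbl \<zeta>))"
      by (simp add: \<zeta>_def eis_add eis_one eis_zero omega_eis flip: g.hom_add g.hom_one g.hom_zero)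
    then have "\<phi> (A_to_K (eis 1 8)) = \<one>\<^bsub>field_K\<^esub> \<oplus>\<^bsub>field_K\<^esub> ?dbl (?dbl (?dbl ?\<eta>))"
      using \<zeta>(1) one_R by (simp add: \<phi>_add \<phi>_one closed)
    also have "\<dots> = A_to_K (eis (- 7) (- 8))"
      unfolding \<eta>_eq
      by (simp add: eis_add eis_one eis_zero omega_eis flip: g.hom_add g.hom_one g.hom_zero)
    finally have "\<phi> w \<otimes>\<^bsub>field_K\<^esub> \<phi> w = A_to_K (eis (- 7) (- 8))"
      using \<phi>_mult[OF w_R w_R] w(2) by simp
    moreover have "\<phi> w \<in> generate_field field_K (L_in_K \<union> {w})" using \<phi>_R[OF w_R] carr by simp
    ultimately show False using conj_sqrt_not_in_extension[of w "\<phi> w"] w V_sub by blast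
  qed
qed

theorem theorem5p1:
  shows "unramified_dvr 2 ring_A \<and>
    (\<exists>w \<in> carrier field_K.
       unramified_dvr 2 (ring_R w) \<and> \<not> (\<exists>\<delta>. p_derivation 2 (ring_R w) \<delta>))"
proof -
  obtain r where r: "r \<in> carrier ring_V" "r \<otimes>\<^bsub>ring_V\<^esub> r = to_p_completion ring_A 2 (eis 1 8)"
    by (rule bexE[OF sqrt_in_V])
  define w where "w = to_fraction_field ring_V r"
  interpret K: field field_K by (rule field_K_field)
  have w: "w \<in> V_in_K" "w \<in> carrier field_K" "w \<otimes>\<^bsub>field_K\<^esub> w = A_to_K (eis 1 8)"
    using r(1) ring_hom_closed[OF V_to_K_hom r(1)] ring_hom_mult[OF V_to_K_hom r(1) r(1)]
    unfolding w_def V_in_K_def A_to_K_def r(2) by simp_all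
  have "subfield (generate_field field_K (L_in_K \<union> {w})) field_K"
    using w subringE(1)[OF subfieldE(1)[OF L_in_K_subfield]] by (intro K.generate_field_is_subfield) auto
  then have R: "p_uniformized_ring (ring_R w) 2"
    unfolding ring_R_def V_in_K_def
    by (rule V.subfield_inter_p_uniformized[OF K.field_axioms V_to_K_hom V_to_K_inj])
  have "\<not> p_derivation 2 (ring_R w) \<delta>" for \<delta> by (rule no_2_derivation[OF w(1,3) R])
  then show ?thesis
    using w(2) p_uniformized_ring.is_unramified_dvr[OF A_p_uniformized]
      p_uniformized_ring.is_unramified_dvr[OF R] by metis
qed

end
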